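(* Let $R$ be a (unital, not necessarily commutative) Cu-semiring. Then $\pi_R\colon R\to[\![R,R]\!]$ is multiplicative (where $[\![R,R]\!]$ carries the composition product). If the unit element of $R$ is compact, then $\pi_R$ is unital, that is, $\pi_R(1_R)=\mathrm{id}_R$.
   Context: A positively ordered semigroup is a commutative monoid $(S,+,0)$ with a partial order $\le$ compatible with addition such that $0\le a$ for all $a$. For $a,b\in S$, $a\ll b$ (way-below) means: whenever $(c_n)_n$ is an increasing sequence in $S$ whose supremum exists and satisfies $b\le\sup_n c_n$, there is $k$ with $a\le c_k$. An element $a$ is compact if $a\ll a$. A Cu-semigroup is a positively ordered semigroup satisfying: (O1) every increasing sequence has a supremum; (O2) every $a$ is the supremum of a sequence $(a_n)_n$ with $a_n\ll a_{n+1}$ for all $n$; (O3) $a'\ll a$ and $b'\ll b$ imply $a'+b'\ll a+b$; (O4) $\sup_n(a_n+b_n)=\sup_n a_n+\sup_n b_n$ for increasing sequences. A generalized Cu-morphism is a map between Cu-semigroups preserving addition, zero, order and suprema of increasing sequences; a Cu-morphism additionally preserves $\ll$. $\mathrm{Cu}[S,T]$ and $\mathrm{Cu}(S,T)$ denote the sets of generalized Cu-morphisms and of Cu-morphisms $S\to T$, with pointwise order and addition. A Cu-bimorphism $\varphi\colon S\times T\to P$ is a map that is additive, zero- and order-preserving in each variable, satisfies $\sup_k\varphi(a_k,b_k)=\varphi(\sup_k a_k,\sup_k b_k)$ for increasing sequences, and satisfies $\varphi(a',b')\ll\varphi(a,b)$ whenever $a'\ll a$ and $b'\ll b$. $S\otimes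 T$ denotes the Cu-semigroup with universal Cu-bimorphism $S\times T\to S\otimes T$, $(a,b)\mapsto a\otimes b$: every Cu-bimorphism $S\times T\to P$ factors through a unique Cu-morphism $S\otimes T\to P$, and Cu-morphisms $\alpha_1,\alpha_2\colon S\otimes T\to P$ satisfy $\alpha_1\le\alpha_2$ iff $\alpha_1(a\otimes b)\le\alpha_2(a\otimes b)$ for all $a,b$. The tensor product is associative up to natural isomorphism. Let $I_{\mathbb Q}=\mathbb Q\cap(0,1)$. For $\varphi,\psi\in\mathrm{Cu}[S,T]$ write $\varphi\prec\psi$ if $\varphi(a')\ll\psi(a)$ whenever $a'\ll a$ in $S$. A path in $\mathrm{Cu}[S,T]$ is a family $\mathbf f=(f_\lambda)_{\lambda\in I_{\mathbb Q}}$ with $f_{\lambda'}\prec f_\lambda$ whenever $\lambda'<\lambda$. Write $\mathbf f\lesssim\mathbf g$ if for every $\lambda$ there is $\mu$ with $f_\lambda\prec g_\mu$. The internal hom $[\![S,T]\!]$ is the set of classes $[\mathbf f]$ of paths modulo ($\mathbf f\lesssim\mathbf g$ and $\mathbf g\lesssim\mathbf f$), with $[\mathbf f]+[\mathbf g]=[(f_\lambda+g_\lambda)_\lambda]$ and $[\mathbf f]\le[\mathbf g]$ iff $\mathbf f\lesssim\mathbf g$; it is a Cu-semigroup. A Cu-morphism $\varphi\colon S\to T$ satisfies $\varphi\prec\varphi$ and is identified with the class of the constant path $(\varphi)_\lambda$ in $[\![S,T]\!]$. The endpoint map $\sigma_{S,T}\colon[\![S,T]\!]\to\mathrm{Cu}[S,T]$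 is $\sigma_{S,T}([\mathbf f])(a)=\sup_\lambda f_\lambda(a)$. It is known that for Cu-semigroups $S,T,P$ there is a bijection $\mathrm{Cu}(S,[\![T,P]\!])\cong\mathrm{Cu}(S\otimes T,P)$ sending $\alpha$ to the Cu-morphism $a\otimes b\mapsto\sigma_{T,P}(\alpha(a))(b)$. The evaluation map $\mathrm e_{S,T}\colon[\![S,T]\!]\otimes S\to T$ is the Cu-morphism corresponding to $\mathrm{id}_{[\![S,T]\!]}$. The composition product $\circ\colon[\![T,P]\!]\otimes[\![S,T]\!]\to[\![S,P]\!]$, $y\otimes x\mapsto y\circ x$, is the Cu-morphism corresponding to $\mathrm e_{T,P}\circ(\mathrm{id}_{[\![T,P]\!]}\otimes\mathrm e_{S,T})\colon[\![T,P]\!]\otimes[\![S,T]\!]\otimes S\to P$. It is known that $[\![S,S]\!]$ with this product is a Cu-semiring with unit $\mathrm{id}_S$. A Cu-semiring is a Cu-semigroup $R$ with a Cu-bimorphism $R\times R\to R$, $(r,s)\mapsto rs$, that is associative, and an element $1_R\in R$ with $r1_R=r=1_Rr$ for all $r$. $\mu_R\colon R\otimes R\to R$ is the Cu-morphism induced by multiplication. $\pi_R\colon R\to[\![R,R]\!]$ is the Cu-morphism corresponding to $\mu_R$ under $\mathrm{Cu}(R,[\![R,R]\!])\cong\mathrm{Cu}(R\otimes R,R)$. *)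

theory Defs
  imports Complex_Main "HOL-Library.Multiset" "HOL-Library.Countable_Set"
begin

section \<open>Cu-semigroups\<close>

text \<open>
  Inside the class context \<^term>\<open>incseq c\<close> has to be spelled \<open>monotone (\<le>) (\<le>) c\<close>, of which it is
  an abbreviation.
\<close>

context order
begin

definition is_sup :: "'a set \<Rightarrow> 'a \<Rightarrow> bool" where
  "is_sup A s \<longleftrightarrow> (\<forall>x\<in>A. x \<le> s) \<and> (\<forall>u. (\<forall>x\<in>A. x \<le> u) \<longrightarrow> s \<le> u)"

definition way_below :: "'a \<Rightarrow> 'a \<Rightarrow> bool" (infix "\<lless>" 50) where
  "a \<lless> b \<longleftrightarrow> (\<forall>c :: nat \<Rightarrow> 'a. \<forall>s. monotone (\<le>) (\<le>) c \<longrightarrow> is_sup (range c) s \<longrightarrow> b \<le> s \<longrightarrow> (\<exists>k. a \<le> c k))"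

definition compact_elem :: "'a \<Rightarrow> bool" where
  "compact_elem a \<longleftrightarrow> a \<lless> a"

end

class positively_ordered_semigroup = ordered_comm_monoid_add +
  assumes zero_least: "0 \<le> a"

class cu_semigroup = positively_ordered_semigroup +
  assumes O1: "monotone (\<le>) (\<le>) (c :: nat \<Rightarrow> 'a) \<Longrightarrow> \<exists>s. is_sup (range c) s"
    and O2: "\<exists>c. (\<forall>n. c n \<lless> c (Suc n)) \<and> is_sup (range c) a"
    and O3: "a' \<lless> a \<Longrightarrow> b' \<lless> b \<Longrightarrow> a' + b' \<lless> a + b"
    and O4: "monotone (\<le>) (\<le>) (c :: nat \<Rightarrow> 'a) \<Longrightarrow> monotone (\<le>) (\<le>) d
      \<Longrightarrow> is_sup (range c) s \<Longrightarrow> is_sup (range d) t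
      \<Longrightarrow> is_sup (range (\<lambda>n. c n + d n)) (s + t)"

definition generalized_cu_morphism :: "('a::cu_semigroup \<Rightarrow> 'b::cu_semigroup) \<Rightarrow> bool" where
  "generalized_cu_morphism f \<longleftrightarrow>
     (\<forall>a b. f (a + b) = f a + f b) \<and> f 0 = 0 \<and> mono f \<and>
     (\<forall>c s. incseq c \<longrightarrow> is_sup (range c) s \<longrightarrow> is_sup (range (\<lambda>n. f (c n))) (f s))"

definition cu_morphism :: "('a::cu_semigroup \<Rightarrow> 'b::cu_semigroup) \<Rightarrow> bool" where
  "cu_morphism f \<longleftrightarrow> generalized_cu_morphism f \<and> (\<forall>a' a. a' \<lless> a \<longrightarrow> f a' \<lless> f a)"

definition cu_bimorphism ::
  "('a::cu_semigroup \<Rightarrow> 'b::cu_semigroup \<Rightarrow> 'c::cu_semigroup) \<Rightarrow> bool" where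
  "cu_bimorphism \<phi> \<longleftrightarrow>
     (\<forall>a a' b. \<phi> (a + a') b = \<phi> a b + \<phi> a' b) \<and> (\<forall>a b b'. \<phi> a (b + b') = \<phi> a b + \<phi> a b') \<and>
     (\<forall>b. \<phi> 0 b = 0) \<and> (\<forall>a. \<phi> a 0 = 0) \<and>
     (\<forall>b. mono (\<lambda>a. \<phi> a b)) \<and> (\<forall>a. mono (\<phi> a)) \<and>
     (\<forall>c d s t. incseq c \<longrightarrow> incseq d \<longrightarrow> is_sup (range c) s \<longrightarrow> is_sup (range d) t \<longrightarrow>
        is_sup (range (\<lambda>k. \<phi> (c k) (d k))) (\<phi> s t)) \<and>
     (\<forall>a' a b' b. a' \<lless> a \<longrightarrow> b' \<lless> b \<longrightarrow> \<phi> a' b' \<lless> \<phi> a b)"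

class cu_semiring = cu_semigroup + semiring_0 + monoid_mult +
  assumes mult_left_mono_cu: "r \<le> s \<Longrightarrow> t * r \<le> t * s"
    and mult_right_mono_cu: "r \<le> s \<Longrightarrow> r * t \<le> s * t"
    and mult_sup: "monotone (\<le>) (\<le>) (c :: nat \<Rightarrow> 'a) \<Longrightarrow> monotone (\<le>) (\<le>) d
      \<Longrightarrow> is_sup (range c) s \<Longrightarrow> is_sup (range d) t \<Longrightarrow> is_sup (range (\<lambda>n. c n * d n)) (s * t)"
    and mult_way_below: "r' \<lless> r \<Longrightarrow> s' \<lless> s \<Longrightarrow> r' * s' \<lless> r * s"

lemma mult_bimorphism: "cu_bimorphism (\<lambda>r s :: 'a::cu_semiring. r * s)"
  unfolding cu_bimorphism_def
  by (auto simp: distrib_left distrib_right intro: monoI mult_left_mono_cu mult_right_mono_cu mult_sup mult_way_below)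


subsection \<open>Basic facts\<close>

lemma is_supI: "(\<And>x. x \<in> A \<Longrightarrow> x \<le> s) \<Longrightarrow> (\<And>u. (\<And>x. x \<in> A \<Longrightarrow> x \<le> u) \<Longrightarrow> s \<le> u) \<Longrightarrow> is_sup A s"
  by (auto simp: is_sup_def)

lemma is_sup_upper: "is_sup A s \<Longrightarrow> x \<in> A \<Longrightarrow> x \<le> s"
  by (auto simp: is_sup_def)

lemma is_sup_least: "is_sup A s \<Longrightarrow> (\<And>x. x \<in> A \<Longrightarrow> x \<le> u) \<Longrightarrow> s \<le> u"
  by (auto simp: is_sup_def)

lemma is_sup_unique: "is_sup A s \<Longrightarrow> is_sup A t \<Longrightarrow> s = t"
  by (meson is_sup_least is_sup_upper order_antisym)

lemma is_sup_cofinal: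
  assumes "is_sup A s" "\<And>x. x \<in> A \<Longrightarrow> \<exists>y\<in>B. x \<le> y" "\<And>y. y \<in> B \<Longrightarrow> \<exists>x\<in>A. y \<le> x"
  shows "is_sup B s"
proof (rule is_supI)
  show "y \<le> s" if "y \<in> B" for y
    using assms(3)[OF that] is_sup_upper[OF assms(1)] order_trans by blast
  show "s \<le> u" if "\<And>y. y \<in> B \<Longrightarrow> y \<le> u" for u
    by (rule is_sup_least[OF assms(1)]) (use assms(2) that order_trans in blast)
qed

lemma way_belowD: "a \<lless> b \<Longrightarrow> incseq c \<Longrightarrow> is_sup (range c) s \<Longrightarrow> b \<le> s \<Longrightarrow> \<exists>k. a \<le> c k"
  unfolding way_below_def by blast

lemma way_below_imp_le: "a \<lless> b \<Longrightarrow> a \<le> b"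
  using way_belowD[of a b "\<lambda>_. b" b] by (auto intro: is_supI simp: mono_def)

lemma way_below_mono: "a' \<le> a \<Longrightarrow> a \<lless> b \<Longrightarrow> b \<le> b' \<Longrightarrow> a' \<lless> b'"
  unfolding way_below_def by (meson order_trans)

lemma way_below_le_trans [trans]: "a \<lless> b \<Longrightarrow> b \<le> c \<Longrightarrow> a \<lless> c"
  using way_below_mono by blast

lemma le_way_below_trans [trans]: "a \<le> b \<Longrightarrow> b \<lless> c \<Longrightarrow> a \<lless> c"
  using way_below_mono by blast

lemma way_below_trans [trans]: "a \<lless> b \<Longrightarrow> b \<lless> c \<Longrightarrow> a \<lless> c"
  using way_below_mono way_below_imp_le by blast

lemma zero_way_below: "0 \<lless> (a::'a::cu_semigroup)"
  unfolding way_below_def using zero_least by blast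

lemma ex_approx_seq:
  fixes a :: "'a::cu_semigroup"
  shows "\<exists>c. (\<forall>n. c n \<lless> c (Suc n)) \<and> incseq c \<and> is_sup (range c) a \<and> (\<forall>n. c n \<lless> a)"
proof -
  obtain c where c: "\<And>n. c n \<lless> c (Suc n)" "is_sup (range c) a" using O2 by blast
  have "incseq c" using c(1) by (auto intro: incseq_SucI way_below_imp_le)
  moreover have "c n \<lless> a" for n
    using way_below_le_trans[OF c(1)] is_sup_upper[OF c(2)] by blast
  ultimately show ?thesis using c by blast
qed

lemma le_if_way_below:
  fixes a :: "'a::cu_semigroup"
  assumes "\<And>a'. a' \<lless> a \<Longrightarrow> a' \<le> b"
  shows "a \<le> b"
proof -
  obtain c :: "nat \<Rightarrow> 'a" where "is_sup (range c) a" "\<And>n. c n \<lless> a" using ex_approx_seq[of a] by blast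
  thus ?thesis using assms by (auto intro: is_sup_least)
qed

lemma way_below_interp:
  fixes u :: "'a::cu_semigroup"
  assumes "finite L" "\<forall>x\<in>L. x \<lless> u"
  shows "\<exists>z. (\<forall>x\<in>L. x \<lless> z) \<and> z \<lless> u"
proof -
  obtain c where c: "\<And>n. c n \<lless> c (Suc n)" "incseq c" "is_sup (range c) u" "\<And>n. c n \<lless> u"
    using ex_approx_seq[of u] by blast
  have "\<exists>k. x \<lless> c k" if "x \<in> L" for x
  proof -
    have "x \<lless> u" using assms(2) that by blast
    then obtain k where "x \<le> c k" using way_belowD[OF _ c(2,3) order_refl] by blast
    thus ?thesis using c(1) le_way_below_trans by blast
  qed
  then obtain k where k: "\<And>x. x \<in> L \<Longrightarrow> x \<lless> c (k x)" by metis
  have "x \<lless> c (Max (insert 0 (k ` L)))" if "x \<in> L" for x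
  proof -
    have "k x \<le> Max (insert 0 (k ` L))" using assms(1) that by (intro Max_ge) auto
    hence "c (k x) \<le> c (Max (insert 0 (k ` L)))" using c(2) by (meson monoD)
    thus ?thesis using way_below_le_trans k that by blast
  qed
  thus ?thesis using c(4) by blast
qed

lemma way_below_interp1:
  fixes a :: "'a::cu_semigroup"
  assumes "a \<lless> b"
  obtains c where "a \<lless> c" "c \<lless> b"
  using way_below_interp[of "{a}" b] assms by auto


section \<open>Rational chains\<close>

definition IQ :: "rat set" where
  "IQ = {0<..<1}"

lemma IQ_half: "l \<in> IQ \<Longrightarrow> l / 2 \<in> IQ \<and> l / 2 < l"
  by (auto simp: IQ_def)

lemma IQ_between: "l \<in> IQ \<Longrightarrow> m \<in> IQ \<Longrightarrow> l < m \<Longrightarrow> \<exists>t\<in>IQ. l < t \<and> t < m"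
  using dense[of l m] by (auto simp: IQ_def)

lemma IQ_above: "l \<in> IQ \<Longrightarrow> \<exists>t\<in>IQ. l < t"
  using dense[of l 1] by (auto simp: IQ_def)

lemma IQ_above2: "l \<in> IQ \<Longrightarrow> m \<in> IQ \<Longrightarrow> \<exists>t\<in>IQ. l < t \<and> m < t"
  by (metis IQ_above linorder_less_linear order.strict_trans)

lemma IQ_nonempty: "1/2 \<in> IQ"
  by (auto simp: IQ_def)

lemma IQ_infinite: "infinite IQ"
  by (auto simp: IQ_def intro: infinite_Ioo)

definition tseq :: "nat \<Rightarrow> rat" where
  "tseq n = 1 - 1 / of_nat (n + 2)"

lemma tseq_IQ: "tseq n \<in> IQ"
  by (auto simp: tseq_def IQ_def field_simps)

lemma tseq_less: "m < n \<Longrightarrow> tseq m < tseq n"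
  by (auto simp: tseq_def field_simps)

lemma tseq_strict: "strict_mono tseq"
  by (rule strict_monoI) (rule tseq_less)

lemma tseq_cofinal: "l \<in> IQ \<Longrightarrow> \<exists>n. l < tseq n"
proof -
  assume l: "l \<in> IQ"
  obtain n where n: "1 / (1 - l) < of_nat n" using reals_Archimedean2 by blast
  have "0 < 1 - l" using l by (auto simp: IQ_def)
  hence "1 < of_nat n * (1 - l)" using n by (simp add: field_simps)
  also have "\<dots> \<le> of_nat (n + 2) * (1 - l)" using \<open>0 < 1 - l\<close> by (intro mult_right_mono) auto
  finally have "1 / of_nat (n + 2) < 1 - l" by (simp add: field_simps)
  hence "l < tseq n" by (simp add: tseq_def)
  thus ?thesis by blast
qed

lemma finite_chain_min:
  assumes "finite U" "U \<noteq> {}" "\<And>x y z. R x y \<Longrightarrow> R y z \<Longrightarrow> R x z"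
    "\<And>x y. x \<in> U \<Longrightarrow> y \<in> U \<Longrightarrow> x = y \<or> R x y \<or> R y x"
  shows "\<exists>u\<in>U. \<forall>v\<in>U. v = u \<or> R u v"
  using assms(1,2,4)
proof (induction U rule: finite_ne_induct)
  case (insert x F)
  then obtain u where u: "u \<in> F" "\<forall>v\<in>F. v = u \<or> R u v" by blast
  consider "x = u \<or> R u x" | "R x u" using insert.prems[of x u] u(1) by blast
  thus ?case
  proof cases
    case 2
    hence "\<forall>v\<in>F. R x v" using u(2) assms(3)[of x u] by auto
    thus ?thesis by auto
  qed (use u in auto)
qed auto

lemma rational_chain:
  assumes tr: "\<And>x y z. R x y \<Longrightarrow> R y z \<Longrightarrow> R x z"
    and interp: "\<And>L u. finite L \<Longrightarrow> \<forall>x\<in>L. R x u \<Longrightarrow> \<exists>v. R u v \<Longrightarrow> \<exists>z. (\<forall>x\<in>L. R x z) \<and> R z u"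
    and e: "\<And>n. R (e n) (e (Suc n))"
  obtains p :: "rat \<Rightarrow> 'x" where "\<And>l m. l \<in> IQ \<Longrightarrow> m \<in> IQ \<Longrightarrow> l < m \<Longrightarrow> R (p l) (p m)"
    "\<And>n. \<exists>l\<in>IQ. R (e n) (p l)" "\<And>l. l \<in> IQ \<Longrightarrow> \<exists>n. R (p l) (e n)"
proof -
  have ee: "R (e m) (e n)" if "m < n" for m n
    using that by (induction n) (auto simp: less_Suc_eq intro: e tr)
  define q where "q = from_nat_into IQ"
  have q: "bij_betw q UNIV IQ"
    unfolding q_def by (rule bij_betw_from_nat_into) (auto simp: IQ_infinite)
  define P where "P f n z \<longleftrightarrow> (\<forall>i<n. q i < q n \<longrightarrow> R (f i) z) \<and> (\<forall>i<n. q n < q i \<longrightarrow> R z (f i)) \<and>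
     (\<forall>m. tseq m < q n \<longrightarrow> R (e m) z) \<and> (\<forall>m. q n \<le> tseq m \<longrightarrow> R z (e m))" for f n z
  have "\<exists>f. \<forall>n::nat. P f n (f n)"
  proof (rule dependent_wellorder_choice)
    show "P f n z = P g n z" if "\<And>i. i < n \<Longrightarrow> f i = g i" for z f g n
      using that by (auto simp: P_def)
    fix n f assume f: "\<And>i. i < n \<Longrightarrow> P f i (f i)"
    have qI: "q n \<in> IQ" using q by (auto simp: bij_betw_def)
    define M where "M = (LEAST m. q n \<le> tseq m)"
    have M: "q n \<le> tseq M" "\<And>m. m < M \<Longrightarrow> tseq m < q n"
    proof -
      obtain k where "q n \<le> tseq k" using tseq_cofinal[OF qI] less_imp_le by blast
      thus "q n \<le> tseq M" unfolding M_def by (rule LeastI)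
      show "tseq m < q n" if "m < M" for m using not_less_Least[of m "\<lambda>m. q n \<le> tseq m"] that unfolding M_def by (simp add: not_le)
    qed
    have Mle: "m < M" if "tseq m < q n" for m
    proof (rule ccontr)
      assume "\<not> m < M"
      hence "tseq M \<le> tseq m" using tseq_strict by (simp add: strict_mono_less_eq)
      thus False using that M(1) by simp
    qed
    have Mge: "M \<le> m" if "q n \<le> tseq m" for m using that M(2) by (meson linorder_not_le)
    have ff: "R (f i) (f j)" if "i < n" "j < n" "q i < q j" for i j
    proof (cases "i < j")
      case True thus ?thesis using f[of j] that by (auto simp: P_def)
    next
      case False
      moreover have "i \<noteq> j" using that by auto
      ultimately have "j < i" by simp
      thus ?thesis using f[of i] that by (auto simp: P_def)
    qed
    define L where "L = f ` {i. i < n \<and> q i < q n} \<union> e ` {..<M}"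
    define U where "U = insert (e M) (f ` {i. i < n \<and> q n < q i})"
    have fe: "R (f i) (e M)" if "i < n" "q i \<le> tseq M" for i using f[OF that(1)] that by (auto simp: P_def)
    have ef: "R (e m) (f i)" if "i < n" "tseq m < q i" for i m using f[OF that(1)] that by (auto simp: P_def)
    have "\<exists>u\<in>U. \<forall>v\<in>U. v = u \<or> R u v"
    proof (rule finite_chain_min)
      have eq: "f i = f j \<or> R (f i) (f j) \<or> R (f j) (f i)" if "i < n" "j < n" for i j
      proof (cases "i = j")
        case False
        hence "q i \<noteq> q j" using q by (auto simp: bij_betw_def inj_def)
        thus ?thesis using that ff[of i j] ff[of j i] by linarith
      qed simp
      have eq2: "R (f i) (e M) \<or> R (e M) (f i)" if "i < n" for i
        using fe[OF that] ef[OF that, of M] by linarith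
      show "x = y \<or> R x y \<or> R y x" if "x \<in> U" "y \<in> U" for x y
        using that eq eq2 unfolding U_def by auto
      show "R x z" if "R x y" "R y z" for x y z using tr that by metis
    qed (auto simp: U_def)
    then obtain u where u: "u \<in> U" "\<forall>v\<in>U. v = u \<or> R u v" by blast
    have "R x v" if "x \<in> L" "v \<in> U" for x v
    proof -
      have a: "R (f i) (e M)" if "i < n" "q i < q n" for i using fe[OF that(1)] that(2) M(1) by simp
      have b: "R (f i) (f j)" if "i < n" "q i < q n" "j < n" "q n < q j" for i j
        using ff[OF that(1,3)] that by simp
      have c: "R (e m) (f j)" if "m < M" "j < n" "q n < q j" for m j
        using ef[OF that(2), of m] that M(2)[of m] by simp
      show ?thesis using that a b c ee unfolding L_def U_def by auto
    qed
    moreover have "finite L" by (auto simp: L_def)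
    moreover have "\<exists>v. R u v"
    proof -
      have "\<exists>m. q i \<le> tseq m" for i
        using tseq_cofinal[of "q i"] q bij_betwE less_imp_le by blast
      hence "\<exists>m. R (f i) (e m)" if "i < n" for i using f[OF that] unfolding P_def by blast
      thus ?thesis using u(1) e[of M] unfolding U_def by auto
    qed
    ultimately obtain z where z: "\<forall>x\<in>L. R x z" "R z u" using interp[of L u] u(1) by blast
    have zU: "R z v" if "v \<in> U" for v using z(2) u(2) that tr[of z u v] by auto
    have "P f n z" unfolding P_def
    proof (intro conjI allI impI)
      show "R (f i) z" if "i < n" "q i < q n" for i using z(1) that by (auto simp: L_def)
      show "R z (f i)" if "i < n" "q n < q i" for i using zU that by (auto simp: U_def)
      show "R (e m) z" if "tseq m < q n" for m using z(1) Mle[OF that] by (auto simp: L_def)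
      show "R z (e m)" if "q n \<le> tseq m" for m
    proof (cases "m = M")
      case False
      hence "R (e M) (e m)" using Mge[OF that] ee[of M m] by simp
      moreover have "R z (e M)" using zU by (simp add: U_def)
      ultimately show ?thesis by (metis tr)
    qed (use zU in \<open>auto simp: U_def\<close>)
    qed
    thus "\<exists>z. P f n z" by blast
  qed
  then obtain f where f: "\<And>n. P f n (f n)" by blast
  define p where "p l = f (inv q l)" for l
  have iq: "q (inv q l) = l" if "l \<in> IQ" for l using that q by (metis bij_betw_imp_surj_on f_inv_into_f)
  have 1: "R (p l) (p m)" if lm: "l \<in> IQ" "m \<in> IQ" "l < m" for l m
  proof (cases "inv q l < inv q m")
    case True thus ?thesis using f[of "inv q m"] lm iq by (auto simp: P_def p_def)
  next
    case False
    moreover have "inv q m \<noteq> inv q l" using lm iq[of l] iq[of m] by auto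
    ultimately have "inv q m < inv q l" by simp
    thus ?thesis using f[of "inv q l"] lm iq by (auto simp: P_def p_def)
  qed
  have 2: "\<exists>l\<in>IQ. R (e n) (p l)" for n
    using f[of "inv q (tseq (Suc n))"] iq[OF tseq_IQ, of "Suc n"] tseq_less[of n "Suc n"] tseq_IQ[of "Suc n"]
    by (intro bexI[of _ "tseq (Suc n)"]) (auto simp: P_def p_def)
  have 3: "\<exists>n. R (p l) (e n)" if "l \<in> IQ" for l
    using f[of "inv q l"] iq[OF that] tseq_cofinal[OF that] by (auto simp: P_def p_def intro: less_imp_le)
  show ?thesis by (rule that[OF 1 2 3])
qed

lemma cofinal_sequence:
  assumes tr: "\<And>x y z. R x y \<Longrightarrow> R y z \<Longrightarrow> R x z"
    and "countable A" "A \<noteq> {}" and dir: "\<And>x y. x \<in> A \<Longrightarrow> y \<in> A \<Longrightarrow> \<exists>z\<in>A. R x z \<and> R y z"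
  obtains e :: "nat \<Rightarrow> 'x" where "\<And>n. e n \<in> A" "\<And>n. R (e n) (e (Suc n))" "\<And>x. x \<in> A \<Longrightarrow> \<exists>n. R x (e n)"
proof -
  define a where "a = from_nat_into A"
  have a: "range a = A" unfolding a_def using assms by (simp add: range_from_nat_into)
  have aA: "a n \<in> A" for n using a by auto
  have "\<exists>e. \<forall>n. e n \<in> A \<and> (R (e n) (e (Suc n)) \<and> R (a n) (e (Suc n)))"
    by (rule dependent_nat_choice) (use dir aA in blast)+
  then obtain e where "\<forall>n. e n \<in> A \<and> (R (e n) (e (Suc n)) \<and> R (a n) (e (Suc n)))" by blast
  thus ?thesis using that[of e] a by blast
qed

section \<open>Path completion\<close>

text \<open>
  Both the internal hom and the tensor product arise by the same construction: classes of paths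
  in a commutative monoid carrying an additive transitive relation.
\<close>

class prec_monoid = comm_monoid_add +
  fixes prec :: "'a \<Rightarrow> 'a \<Rightarrow> bool" (infix "\<prec>" 50)
  assumes prec_trans: "a \<prec> b \<Longrightarrow> b \<prec> c \<Longrightarrow> a \<prec> c"
    and prec_add: "a' \<prec> a \<Longrightarrow> b' \<prec> b \<Longrightarrow> a' + b' \<prec> a + b"
    and zero_prec: "0 \<prec> a"

text \<open>
  A path is indexed by \<^const>\<open>IQ\<close>, the rationals in the open unit interval; values of the function
  outside \<^const>\<open>IQ\<close> are ignored throughout.
\<close>

definition is_path :: "(rat \<Rightarrow> 'a::prec_monoid) \<Rightarrow> bool" where
  "is_path f \<longleftrightarrow> (\<forall>l\<in>IQ. \<forall>m\<in>IQ. l < m \<longrightarrow> f l \<prec> f m)"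

definition path_le :: "(rat \<Rightarrow> 'a::prec_monoid) \<Rightarrow> (rat \<Rightarrow> 'a) \<Rightarrow> bool" (infix "\<lesssim>" 50) where
  "f \<lesssim> g \<longleftrightarrow> (\<forall>l\<in>IQ. \<exists>m\<in>IQ. f l \<prec> g m)"

definition path_equiv :: "(rat \<Rightarrow> 'a::prec_monoid) \<Rightarrow> (rat \<Rightarrow> 'a) \<Rightarrow> bool" where
  "path_equiv f g \<longleftrightarrow> is_path f \<and> is_path g \<and> f \<lesssim> g \<and> g \<lesssim> f"

lemma pathD: "is_path f \<Longrightarrow> l \<in> IQ \<Longrightarrow> m \<in> IQ \<Longrightarrow> l < m \<Longrightarrow> f l \<prec> f m"
  by (auto simp: is_path_def)

lemma path_le_refl: "is_path f \<Longrightarrow> f \<lesssim> f"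
  unfolding path_le_def using IQ_above pathD by blast

lemma path_le_trans: "f \<lesssim> g \<Longrightarrow> g \<lesssim> h \<Longrightarrow> f \<lesssim> h"
  unfolding path_le_def by (meson prec_trans)

lemma path_zero: "is_path (\<lambda>_. 0)"
  by (auto simp: is_path_def zero_prec)

lemma path_add: "is_path f \<Longrightarrow> is_path g \<Longrightarrow> is_path (\<lambda>l. f l + g l)"
  by (auto simp: is_path_def prec_add)

lemma path_le_add:
  assumes "is_path f'" "is_path g'" "f \<lesssim> f'" "g \<lesssim> g'"
  shows "(\<lambda>l. f l + g l) \<lesssim> (\<lambda>l. f' l + g' l)"
  unfolding path_le_def
proof
  fix l assume "l \<in> IQ"
  then obtain m n where mn: "m \<in> IQ" "n \<in> IQ" "f l \<prec> f' m" "g l \<prec> g' n"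
    using assms(3,4) unfolding path_le_def by blast
  obtain t where t: "t \<in> IQ" "m < t" "n < t" using IQ_above2 mn(1,2) by blast
  have "f l \<prec> f' t" "g l \<prec> g' t"
    using prec_trans[OF mn(3) pathD[OF assms(1) mn(1) t(1,2)]]
      prec_trans[OF mn(4) pathD[OF assms(2) mn(2) t(1,3)]] .
  thus "\<exists>m\<in>IQ. f l + g l \<prec> f' m + g' m" using t(1) prec_add by blast
qed

quotient_type (overloaded) 'a path_class = "rat \<Rightarrow> 'a::prec_monoid" / partial: path_equiv
  morphisms rep_path class_of
proof (rule part_equivpI)
  show "\<exists>x. path_equiv x x"
    using path_zero path_le_refl unfolding path_equiv_def by blast
  show "symp path_equiv" by (auto simp: symp_def path_equiv_def)
  show "transp path_equiv" by (auto simp: transp_def path_equiv_def intro: path_le_trans)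
qed

instantiation path_class :: (prec_monoid) ordered_comm_monoid_add
begin

lift_definition less_eq_path_class :: "'a path_class \<Rightarrow> 'a path_class \<Rightarrow> bool" is path_le
  unfolding path_equiv_def by (meson path_le_trans)

definition less_path_class :: "'a path_class \<Rightarrow> 'a path_class \<Rightarrow> bool" where
  "less_path_class x y \<longleftrightarrow> x \<le> y \<and> \<not> y \<le> x"

lift_definition plus_path_class :: "'a path_class \<Rightarrow> 'a path_class \<Rightarrow> 'a path_class" is
  "\<lambda>f g l. f l + g l"
  by (simp add: path_equiv_def path_add path_le_add)

lift_definition zero_path_class :: "'a path_class" is "\<lambda>_. 0"
  by (simp add: path_equiv_def path_zero path_le_refl)

instance
proof
  fix x y z :: "'a path_class"
  show "x + y + z = x + (y + z)"
    by transfer (auto simp: path_equiv_def ac_simps intro: path_add path_le_add path_le_refl)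
  show "x + y = y + x"
    by transfer (auto simp: path_equiv_def ac_simps intro: path_add path_le_add path_le_refl)
  show "0 + x = x"
    by transfer (auto simp: path_equiv_def ac_simps intro: path_add path_le_add path_le_refl)
  show "(x < y) = (x \<le> y \<and> \<not> y \<le> x)" by (rule less_path_class_def)
  show "x \<le> x" by transfer (auto simp: path_equiv_def)
  show "x \<le> y \<Longrightarrow> y \<le> z \<Longrightarrow> x \<le> z" by transfer (rule path_le_trans)
  show "x \<le> y \<Longrightarrow> y \<le> x \<Longrightarrow> x = y" by transfer (auto simp: path_equiv_def)
  show "x \<le> y \<Longrightarrow> z + x \<le> z + y"
    by transfer (auto simp: path_equiv_def intro: path_le_add path_le_refl)
qed

end

lemma class_of_cases: "\<exists>f. is_path f \<and> x = class_of f"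
  by (metis Quotient_path_class Quotient_abs_rep Quotient_rep_reflp path_equiv_def)

lemma le_class_of: "is_path f \<Longrightarrow> is_path g \<Longrightarrow> class_of f \<le> class_of g \<longleftrightarrow> f \<lesssim> g"
  by (intro less_eq_path_class.abs_eq) (auto simp: path_equiv_def path_le_refl)

lemma plus_class_of: "is_path f \<Longrightarrow> is_path g \<Longrightarrow> class_of f + class_of g = class_of (\<lambda>l. f l + g l)"
  by (intro plus_path_class.abs_eq) (auto simp: path_equiv_def path_le_refl)

lemma path_le_chain:
  assumes "\<And>n. is_path (F n)" "\<And>n. F n \<lesssim> F (Suc n)" "m \<le> n"
  shows "F m \<lesssim> F n"
  using assms(3) by (induction n rule: dec_induct) (use assms(1,2) path_le_refl path_le_trans in blast)+

lemma sup_path: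
  assumes F: "\<And>n. is_path (F n)" "\<And>n. F n \<lesssim> F (Suc n)"
  shows "\<exists>h. is_path h \<and> (\<forall>n. F n \<lesssim> h) \<and> (\<forall>l\<in>IQ. \<exists>n. \<exists>m\<in>IQ. h l \<prec> F n m)"
proof -
  define R where "R x y \<longleftrightarrow> snd x \<in> IQ \<and> snd y \<in> IQ \<and>
    (\<exists>t\<in>IQ. t < snd y \<and> F (fst x) (snd x) \<prec> F (fst y) t)" for x y :: "nat \<times> rat"
  have RF: "F (fst x) (snd x) \<prec> F (fst y) (snd y)" if "R x y" for x y
    using that F(1) pathD prec_trans unfolding R_def by metis
  have tr: "R x z" if "R x y" "R y z" for x y z
    using RF[OF that(1)] that unfolding R_def by (meson prec_trans)
  have dir: "\<exists>z\<in>UNIV \<times> IQ. R x z \<and> R y z" if xy: "x \<in> UNIV \<times> IQ" "y \<in> UNIV \<times> IQ" for x y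
  proof -
    define k where "k = max (fst x) (fst y)"
    have "F (fst x) \<lesssim> F k" "F (fst y) \<lesssim> F k" unfolding k_def by (rule path_le_chain[of F, OF F]; simp)+
    then obtain s t where st: "s \<in> IQ" "t \<in> IQ" "F (fst x) (snd x) \<prec> F k s" "F (fst y) (snd y) \<prec> F k t"
      using xy unfolding path_le_def by fastforce
    obtain r where r: "r \<in> IQ" "s < r" "t < r" using IQ_above2 st by blast
    have "R x (k, r)" "R y (k, r)" using xy st r by (auto simp: R_def)
    thus ?thesis using r(1) by blast
  qed
  have interp: "\<exists>z. (\<forall>x\<in>L. R x z) \<and> R z u" if L: "finite L" "\<forall>x\<in>L. R x u" and u: "snd u \<in> IQ" for L u
  proof -
    have "\<exists>t. \<forall>x\<in>L. t x \<in> IQ \<and> t x < snd u \<and> F (fst x) (snd x) \<prec> F (fst u) (t x)"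
      by (rule bchoice) (use L(2) in \<open>auto simp: R_def\<close>)
    then obtain t where t: "\<And>x. x \<in> L \<Longrightarrow> t x \<in> IQ \<and> t x < snd u \<and> F (fst x) (snd x) \<prec> F (fst u) (t x)"
      by blast
    define T where "T = insert (snd u / 2) (t ` L)"
    have T: "finite T" "T \<noteq> {}" using L(1) by (auto simp: T_def)
    have "\<forall>r\<in>T. r \<in> IQ \<and> r < snd u" using t IQ_half[OF u] by (auto simp: T_def)
    hence M: "Max T \<in> IQ" "Max T < snd u" using Max_in[OF T] by blast+
    obtain s where s: "s \<in> IQ" "Max T < s" "s < snd u" using IQ_between[OF M(1) u M(2)] by blast
    obtain r where r: "r \<in> IQ" "s < r" "r < snd u" using IQ_between[OF s(1) u s(3)] by blast
    have "R x (fst u, s)" if x: "x \<in> L" for x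
    proof -
      have "t x \<le> Max T" using T(1) x by (intro Max_ge) (auto simp: T_def)
      hence "t x < s" using s(2) by simp
      thus ?thesis using t[OF x] s(1) L(2) x by (auto simp: R_def)
    qed
    moreover have "R (fst u, s) u" using pathD[OF F(1) s(1) r(1,2)] s r u by (auto simp: R_def)
    ultimately show ?thesis by blast
  qed
  have cA: "countable (UNIV \<times> IQ :: (nat \<times> rat) set)" by auto
  have neA: "(UNIV \<times> IQ :: (nat \<times> rat) set) \<noteq> {}" using IQ_nonempty by auto
  obtain e where e: "\<And>n. e n \<in> UNIV \<times> IQ" "\<And>n. R (e n) (e (Suc n))"
    "\<And>x. x \<in> UNIV \<times> IQ \<Longrightarrow> \<exists>n. R x (e n)"
    by (rule cofinal_sequence[of R "UNIV \<times> IQ"]) (use tr cA neA dir in blast)+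
  have interp': "\<exists>z. (\<forall>x\<in>L. R x z) \<and> R z u" if L: "finite L" "\<forall>x\<in>L. R x u" "\<exists>v. R u v" for L u
    by (rule interp[OF L(1,2)]) (use L(3) in \<open>auto simp: R_def\<close>)
  obtain p where p: "\<And>l m. l \<in> IQ \<Longrightarrow> m \<in> IQ \<Longrightarrow> l < m \<Longrightarrow> R (p l) (p m)"
    "\<And>n. \<exists>l\<in>IQ. R (e n) (p l)" "\<And>l. l \<in> IQ \<Longrightarrow> \<exists>n. R (p l) (e n)"
    by (rule rational_chain[of R e]) (use tr interp' e(2) in blast)+
  define h where "h l = F (fst (p l)) (snd (p l))" for l
  have "is_path h" unfolding is_path_def h_def using p(1) RF by blast
  moreover have "F n \<lesssim> h" for n unfolding path_le_def
  proof
    fix l assume "l \<in> IQ"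
    then obtain k where "R (n, l) (e k)" using e(3)[of "(n, l)"] by auto
    moreover obtain m where "m \<in> IQ" "R (e k) (p m)" using p(2) by blast
    ultimately show "\<exists>m\<in>IQ. F n l \<prec> h m" using RF[OF tr] unfolding h_def by fastforce
  qed
  moreover have "\<exists>n. \<exists>m\<in>IQ. h l \<prec> F n m" if "l \<in> IQ" for l
    using p(3)[OF that] RF e(1) unfolding h_def by (metis mem_Times_iff)
  ultimately show ?thesis by blast
qed


lemma is_sup_class_of:
  assumes "\<And>n. is_path (F n)" "is_path h" "\<And>n. F n \<lesssim> h" "\<And>l. l \<in> IQ \<Longrightarrow> \<exists>n. \<exists>m\<in>IQ. h l \<prec> F n m"
  shows "is_sup (range (\<lambda>n. class_of (F n))) (class_of h)"
proof (rule is_supI)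
  show "x \<le> class_of h" if "x \<in> range (\<lambda>n. class_of (F n))" for x
    using that assms by (auto simp: le_class_of)
  show "class_of h \<le> u" if u: "\<And>x. x \<in> range (\<lambda>n. class_of (F n)) \<Longrightarrow> x \<le> u" for u
  proof -
    obtain g where g: "is_path g" "u = class_of g" using class_of_cases by blast
    have Fg: "F n \<lesssim> g" for n using u[of "class_of (F n)"] g assms(1) by (auto simp: le_class_of)
    have "h \<lesssim> g" unfolding path_le_def
    proof
      fix l assume "l \<in> IQ"
      then obtain n m where nm: "m \<in> IQ" "h l \<prec> F n m" using assms(4) by blast
      then obtain k where "k \<in> IQ" "F n m \<prec> g k" using Fg unfolding path_le_def by blast
      thus "\<exists>m\<in>IQ. h l \<prec> g m" using nm(2) prec_trans by blast
    qed
    thus ?thesis using g assms(2) by (simp add: le_class_of)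
  qed
qed

lemma class_seq_sup:
  fixes c :: "nat \<Rightarrow> 'a::prec_monoid path_class"
  assumes "incseq c"
  shows "\<exists>F h. (\<forall>n. is_path (F n) \<and> c n = class_of (F n)) \<and> is_path h \<and> (\<forall>n. F n \<lesssim> F (Suc n)) \<and>
    (\<forall>l\<in>IQ. \<exists>n. \<exists>m\<in>IQ. h l \<prec> F n m) \<and> is_sup (range c) (class_of h)"
proof -
  have "\<exists>F. \<forall>n. is_path (F n) \<and> c n = class_of (F n)" by (rule choice) (use class_of_cases in blast)
  then obtain F where F: "\<And>n. is_path (F n)" "\<And>n. c n = class_of (F n)" by blast
  have FF: "F n \<lesssim> F (Suc n)" for n
    using assms F by (metis incseq_SucD le_class_of)
  obtain h where h: "is_path h" "\<And>n. F n \<lesssim> h" "\<forall>l\<in>IQ. \<exists>n. \<exists>m\<in>IQ. h l \<prec> F n m"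
    using sup_path[of F, OF F(1) FF] by blast
  have "is_sup (range (\<lambda>n. class_of (F n))) (class_of h)"
    by (rule is_sup_class_of) (use F h in auto)
  hence "is_sup (range c) (class_of h)" using F(2) by simp
  thus ?thesis using F FF h by blast
qed

definition shrink :: "(rat \<Rightarrow> 'a) \<Rightarrow> rat \<Rightarrow> rat \<Rightarrow> 'a" where
  "shrink f s l = f (l * s)"

lemma IQ_mult: "l \<in> IQ \<Longrightarrow> s \<in> IQ \<Longrightarrow> l * s \<in> IQ \<and> l * s < s \<and> l * s < l"
  using mult_strict_right_mono[of l 1 s] mult_strict_left_mono[of s 1 l]
  unfolding IQ_def greaterThanLessThan_iff by (metis less_trans mult_1 mult_1_right zero_less_mult_iff)

lemma path_cut: "is_path f \<Longrightarrow> s \<in> IQ \<Longrightarrow> is_path (shrink f s)"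
  unfolding is_path_def shrink_def using IQ_mult mult_strict_right_mono
  by (metis IQ_def greaterThanLessThan_iff)

lemma cut_le: "is_path f \<Longrightarrow> s \<in> IQ \<Longrightarrow> shrink f s \<lesssim> f"
  unfolding path_le_def shrink_def using IQ_mult pathD by metis

lemma cut_way_below:
  assumes f: "is_path f" and s: "s \<in> IQ"
  shows "class_of (shrink f s) \<lless> class_of f"
  unfolding way_below_def
proof (intro allI impI)
  fix c x assume c: "incseq c" "is_sup (range c) x" "class_of f \<le> x"
  obtain F h where Fh: "\<And>n. is_path (F n) \<and> c n = class_of (F n)" "is_path h"
    "\<forall>l\<in>IQ. \<exists>n. \<exists>m\<in>IQ. h l \<prec> F n m" "is_sup (range c) (class_of h)"
    using class_seq_sup[OF c(1)] by blast
  have "x = class_of h" using is_sup_unique c(2) Fh(4) by blast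
  hence "f \<lesssim> h" using c(3) f Fh(2) by (simp add: le_class_of)
  then obtain m where m: "m \<in> IQ" "f s \<prec> h m" using s unfolding path_le_def by blast
  then obtain n k where k: "k \<in> IQ" "h m \<prec> F n k" using Fh(3) by blast
  have "shrink f s \<lesssim> F n" unfolding path_le_def
  proof
    fix l assume l: "l \<in> IQ"
    have "shrink f s l \<prec> f s" unfolding shrink_def using IQ_mult[OF l s] pathD[OF f] s by blast
    thus "\<exists>m\<in>IQ. shrink f s l \<prec> F n m" using m k prec_trans by blast
  qed
  hence "class_of (shrink f s) \<le> c n" using Fh(1) path_cut[OF f s] by (simp add: le_class_of)
  thus "\<exists>k. class_of (shrink f s) \<le> c k" ..
qed

lemma cut_way_below_cut:
  assumes f: "is_path f" and s: "s \<in> IQ" "t \<in> IQ" "s < t"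
  shows "class_of (shrink f s) \<lless> class_of (shrink f t)"
proof -
  have "shrink f s = shrink (shrink f t) (s / t)" using s by (auto simp: shrink_def IQ_def)
  moreover have "s / t \<in> IQ" using s by (auto simp: IQ_def)
  ultimately show ?thesis using cut_way_below[OF path_cut[OF f s(2)], of "s / t"] by simp
qed

lemma is_sup_cut:
  assumes f: "is_path f"
  shows "is_sup (range (\<lambda>n. class_of (shrink f (tseq n)))) (class_of f)"
proof (rule is_sup_class_of)
  fix l assume l: "l \<in> IQ"
  obtain t where t: "t \<in> IQ" "l < t" using IQ_above[OF l] by blast
  obtain n where n: "t < tseq n" using tseq_cofinal t(1) by blast
  have "t / tseq n \<in> IQ" "f l \<prec> shrink f (tseq n) (t / tseq n)"
    using n t tseq_IQ[of n] pathD[OF f l t] by (auto simp: shrink_def IQ_def)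
  thus "\<exists>n. \<exists>m\<in>IQ. f l \<prec> shrink f (tseq n) m" by blast
qed (use path_cut cut_le tseq_IQ f in blast)+

lemma way_below_class_of:
  assumes "x \<lless> class_of f" "is_path f"
  shows "\<exists>s\<in>IQ. x \<le> class_of (shrink f s)"
proof -
  have "incseq (\<lambda>n. class_of (shrink f (tseq n)))"
    by (intro incseq_SucI way_below_imp_le cut_way_below_cut assms tseq_IQ tseq_less) auto
  thus ?thesis using way_belowD[OF assms(1) _ is_sup_cut[OF assms(2)] order_refl] tseq_IQ by blast
qed

instance path_class :: (prec_monoid) cu_semigroup
proof
  fix x :: "'a path_class"
  obtain f where f: "is_path f" "x = class_of f" using class_of_cases by blast
  show "0 \<le> x" using f
    by (auto simp: zero_path_class.abs_eq le_class_of path_zero path_le_def intro: zero_prec IQ_nonempty)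
  have "class_of (shrink f (tseq n)) \<lless> class_of (shrink f (tseq (Suc n)))" for n
    by (intro cut_way_below_cut f tseq_IQ tseq_less) auto
  thus "\<exists>c. (\<forall>n. c n \<lless> c (Suc n)) \<and> is_sup (range c) x"
    using is_sup_cut[OF f(1)] f(2) by (intro exI[of _ "\<lambda>n. class_of (shrink f (tseq n))"]) auto
next
  fix c :: "nat \<Rightarrow> 'a path_class" assume "monotone (\<le>) (\<le>) c"
  thus "\<exists>s. is_sup (range c) s" using class_seq_sup by blast
next
  fix a' a b' b :: "'a path_class" assume ab: "a' \<lless> a" "b' \<lless> b"
  obtain f g where fg: "is_path f" "a = class_of f" "is_path g" "b = class_of g" using class_of_cases by metis
  obtain s t where st: "s \<in> IQ" "a' \<le> class_of (shrink f s)" "t \<in> IQ" "b' \<le> class_of (shrink g t)"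
    using way_below_class_of ab fg by metis
  obtain r where r: "r \<in> IQ" "s < r" "t < r" using IQ_above2 st by blast
  have "a' \<le> class_of (shrink f r)" "b' \<le> class_of (shrink g r)"
    using st cut_way_below_cut[OF fg(1) st(1) r(1,2)] cut_way_below_cut[OF fg(3) st(3) r(1,3)]
      way_below_imp_le order_trans by blast+
  hence "a' + b' \<le> class_of (shrink f r) + class_of (shrink g r)" by (rule add_mono)
  also have "\<dots> = class_of (shrink (\<lambda>l. f l + g l) r)"
    using fg r by (simp add: plus_class_of path_cut) (simp add: shrink_def[abs_def])
  also have "\<dots> \<lless> class_of (\<lambda>l. f l + g l)" by (intro cut_way_below path_add fg r)
  also have "\<dots> = a + b" using fg by (simp add: plus_class_of)
  finally show "a' + b' \<lless> a + b" .
next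
  fix c d :: "nat \<Rightarrow> 'a path_class" and s t
  assume cd: "monotone (\<le>) (\<le>) c" "monotone (\<le>) (\<le>) d" "is_sup (range c) s" "is_sup (range d) t"
  obtain F h where F: "\<And>n. is_path (F n) \<and> c n = class_of (F n)" "is_path h" "\<And>n. F n \<lesssim> F (Suc n)"
    "\<forall>l\<in>IQ. \<exists>n. \<exists>m\<in>IQ. h l \<prec> F n m" "is_sup (range c) (class_of h)"
    using class_seq_sup[OF cd(1)] by blast
  obtain G k where G: "\<And>n. is_path (G n) \<and> d n = class_of (G n)" "is_path k" "\<And>n. G n \<lesssim> G (Suc n)"
    "\<forall>l\<in>IQ. \<exists>n. \<exists>m\<in>IQ. k l \<prec> G n m" "is_sup (range d) (class_of k)"
    using class_seq_sup[OF cd(2)] by blast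
  have s: "s = class_of h" and t: "t = class_of k" using is_sup_unique cd F(5) G(5) by blast+
  have Fh: "F n \<lesssim> h" for n using is_sup_upper[OF F(5), of "c n"] F(1,2) by (simp add: le_class_of)
  have Gk: "G n \<lesssim> k" for n using is_sup_upper[OF G(5), of "d n"] G(1,2) by (simp add: le_class_of)
  have "is_sup (range (\<lambda>n. class_of (\<lambda>l. F n l + G n l))) (class_of (\<lambda>l. h l + k l))"
  proof (rule is_sup_class_of)
    fix l assume l: "l \<in> IQ"
    obtain n m where m: "m \<in> IQ" "h l \<prec> F n m" using F(4) l by blast
    obtain n' m' where m': "m' \<in> IQ" "k l \<prec> G n' m'" using G(4) l by blast
    define N where "N = max n n'"
    have "F n \<lesssim> F N" by (rule path_le_chain[of F]) (use F in \<open>auto simp: N_def\<close>)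
    moreover have "G n' \<lesssim> G N" by (rule path_le_chain[of G]) (use G in \<open>auto simp: N_def\<close>)
    ultimately have "(\<lambda>_. F n m + G n' m') \<lesssim> (\<lambda>l. F N l + G N l)"
      using m(1) m'(1) F(1) G(1) by (intro path_le_add) (auto simp: path_le_def)
    hence "\<exists>r\<in>IQ. F n m + G n' m' \<prec> F N r + G N r" using l by (auto simp: path_le_def)
    thus "\<exists>n. \<exists>m\<in>IQ. h l + k l \<prec> F n m + G n m" using m(2) m'(2) prec_add prec_trans by blast
  qed (use F G Fh Gk path_add path_le_add in blast)+
  thus "is_sup (range (\<lambda>n. c n + d n)) (s + t)" using F G s t by (simp add: plus_class_of)
qed

section \<open>Extending maps to path classes\<close>

definition path_sup :: "(rat \<Rightarrow> 'b::cu_semigroup) \<Rightarrow> 'b" where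
  "path_sup p = (THE s. is_sup (p ` IQ) s)"

definition IQ_mono :: "(rat \<Rightarrow> 'b::cu_semigroup) \<Rightarrow> bool" where
  "IQ_mono p \<longleftrightarrow> (\<forall>l\<in>IQ. \<forall>m\<in>IQ. l < m \<longrightarrow> p l \<le> p m)"

lemma path_sup_eq: "is_sup (p ` IQ) s \<Longrightarrow> path_sup p = s"
  unfolding path_sup_def using is_sup_unique by blast

lemma IQ_mono_tseq: "IQ_mono p \<Longrightarrow> incseq (\<lambda>n. p (tseq n))"
  by (intro incseq_SucI) (auto simp: IQ_mono_def intro!: tseq_IQ tseq_less)

lemma is_sup_tseq_iff:
  assumes "IQ_mono p"
  shows "is_sup (range (\<lambda>n. p (tseq n))) s \<longleftrightarrow> is_sup (p ` IQ) s"
proof -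
  have 1: "\<exists>y\<in>p ` IQ. x \<le> y" if "x \<in> range (\<lambda>n. p (tseq n))" for x using that tseq_IQ by blast
  have 2: "\<exists>x\<in>range (\<lambda>n. p (tseq n)). y \<le> x" if "y \<in> p ` IQ" for y
    using that assms tseq_IQ tseq_cofinal unfolding IQ_mono_def by blast
  show ?thesis using is_sup_cofinal[OF _ 1 2] is_sup_cofinal[OF _ 2 1] by blast
qed

lemma is_sup_path_sup:
  assumes "IQ_mono p"
  shows "is_sup (p ` IQ) (path_sup p)"
  using O1[OF IQ_mono_tseq[OF assms]] path_sup_eq is_sup_tseq_iff[OF assms] by metis

lemma path_sup_upper: "IQ_mono p \<Longrightarrow> l \<in> IQ \<Longrightarrow> p l \<le> path_sup p"
  using is_sup_path_sup is_sup_upper by blast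

lemma path_sup_least: "IQ_mono p \<Longrightarrow> (\<And>l. l \<in> IQ \<Longrightarrow> p l \<le> u) \<Longrightarrow> path_sup p \<le> u"
  using is_sup_least[OF is_sup_path_sup] by blast

lemma path_sup_mono:
  assumes "IQ_mono p" "IQ_mono q" "\<And>l. l \<in> IQ \<Longrightarrow> \<exists>m\<in>IQ. p l \<le> q m"
  shows "path_sup p \<le> path_sup q"
  using path_sup_least[OF assms(1)] path_sup_upper[OF assms(2)] assms(3) order_trans by meson

lemma path_sup_add:
  assumes "IQ_mono p" "IQ_mono q"
  shows "path_sup (\<lambda>l. p l + q l) = path_sup p + path_sup q"
proof -
  have pq: "IQ_mono (\<lambda>l. p l + q l)" using assms by (auto simp: IQ_mono_def intro: add_mono)
  show ?thesis
    using O4[OF IQ_mono_tseq[OF assms(1)] IQ_mono_tseq[OF assms(2)]] is_sup_path_sup[OF assms(1)]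
      is_sup_path_sup[OF assms(2)] path_sup_eq is_sup_tseq_iff[OF pq] is_sup_tseq_iff[OF assms(1)]
      is_sup_tseq_iff[OF assms(2)] by blast
qed

lemma way_below_path_sup:
  assumes "x \<lless> path_sup p" "IQ_mono p"
  shows "\<exists>l\<in>IQ. x \<le> p l"
  using way_belowD[OF assms(1) IQ_mono_tseq[OF assms(2)]] is_sup_path_sup[OF assms(2)]
    is_sup_tseq_iff[OF assms(2)] tseq_IQ by blast

locale prec_map =
  fixes g :: "'x::prec_monoid \<Rightarrow> 'c::cu_semigroup"
  assumes g_add: "g (x + y) = g x + g y" and g_zero: "g 0 = 0" and g_prec: "x \<prec> y \<Longrightarrow> g x \<lless> g y"
begin

lemma IQ_mono_g: "is_path f \<Longrightarrow> IQ_mono (\<lambda>l. g (f l))"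
  by (auto simp: IQ_mono_def is_path_def intro!: way_below_imp_le g_prec)

lemma g_mono: "is_path f \<Longrightarrow> is_path f' \<Longrightarrow> f \<lesssim> f' \<Longrightarrow> path_sup (\<lambda>l. g (f l)) \<le> path_sup (\<lambda>l. g (f' l))"
  by (intro path_sup_mono IQ_mono_g) (auto simp: path_le_def dest!: bspec way_below_imp_le[OF g_prec])

definition ext :: "'x path_class \<Rightarrow> 'c" where
  "ext x = path_sup (\<lambda>l. g ((SOME f. is_path f \<and> x = class_of f) l))"

lemma ext_class_of:
  assumes "is_path f"
  shows "ext (class_of f) = path_sup (\<lambda>l. g (f l))"
proof -
  define f' where "f' = (SOME f'. is_path f' \<and> class_of f = class_of f')"
  have f': "is_path f'" "class_of f = class_of f'"
    using someI[of "\<lambda>f'. is_path f' \<and> class_of f = class_of f'" f] assms unfolding f'_def by auto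
  hence "f \<lesssim> f'" "f' \<lesssim> f" using le_class_of assms by (metis order_refl)+
  thus ?thesis using g_mono[of f f'] g_mono[of f' f] f' assms unfolding ext_def f'_def[symmetric]
    by (simp add: order_antisym)
qed

lemma cu_morphism_ext: "cu_morphism ext"
  unfolding cu_morphism_def generalized_cu_morphism_def
proof (intro conjI allI impI)
  fix x y :: "'x path_class"
  obtain f f' where f: "is_path f" "x = class_of f" "is_path f'" "y = class_of f'" using class_of_cases by metis
  thus "ext (x + y) = ext x + ext y"
    by (simp add: plus_class_of ext_class_of path_add g_add path_sup_add IQ_mono_g)
next
  have "path_sup (\<lambda>_. 0 :: 'c) = 0"
    by (rule path_sup_eq) (use IQ_nonempty in \<open>auto intro!: is_supI\<close>)
  thus "ext 0 = 0" unfolding zero_path_class.abs_eq by (simp add: ext_class_of path_zero g_zero)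
next
  show m: "mono ext"
  proof
    fix x y :: "'x path_class" assume "x \<le> y"
    moreover obtain f f' where f: "is_path f" "x = class_of f" "is_path f'" "y = class_of f'"
      using class_of_cases by metis
    ultimately show "ext x \<le> ext y" by (auto simp: le_class_of ext_class_of intro: g_mono)
  qed
  fix c :: "nat \<Rightarrow> 'x path_class" and s assume c: "incseq c" "is_sup (range c) s"
  obtain F h where F: "\<And>n. is_path (F n) \<and> c n = class_of (F n)" "is_path h"
    "\<forall>l\<in>IQ. \<exists>n. \<exists>m\<in>IQ. h l \<prec> F n m" "is_sup (range c) (class_of h)"
    using class_seq_sup[OF c(1)] by blast
  have s: "s = class_of h" using is_sup_unique c(2) F(4) by blast
  show "is_sup (range (\<lambda>n. ext (c n))) (ext s)"
  proof (rule is_supI)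
    show "x \<le> ext s" if "x \<in> range (\<lambda>n. ext (c n))" for x
      using that is_sup_upper[OF c(2)] monoD[OF m] by blast
    show "ext s \<le> u" if u: "\<And>x. x \<in> range (\<lambda>n. ext (c n)) \<Longrightarrow> x \<le> u" for u
      unfolding s ext_class_of[OF F(2)]
    proof (rule path_sup_least[OF IQ_mono_g[OF F(2)]])
      fix l assume "l \<in> IQ"
      then obtain n k where k: "k \<in> IQ" "h l \<prec> F n k" using F(3) by blast
      have "g (h l) \<le> g (F n k)" using k(2) g_prec way_below_imp_le by blast
      also have "\<dots> \<le> ext (c n)"
        using F(1)[of n] path_sup_upper[OF IQ_mono_g k(1), of "F n"] by (simp add: ext_class_of)
      also have "\<dots> \<le> u" using u by blast
      finally show "g (h l) \<le> u" .
    qed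
  qed
next
  fix x y :: "'x path_class" assume xy: "x \<lless> y"
  obtain f where f: "is_path f" "y = class_of f" using class_of_cases by blast
  obtain s where s: "s \<in> IQ" "x \<le> class_of (shrink f s)" using way_below_class_of xy f by blast
  obtain t where t: "t \<in> IQ" "s < t" using IQ_above s(1) by blast
  have m: "mono ext"
  proof
    fix x y :: "'x path_class" assume "x \<le> y"
    moreover obtain f f' where f: "is_path f" "x = class_of f" "is_path f'" "y = class_of f'"
      using class_of_cases by metis
    ultimately show "ext x \<le> ext y" by (auto simp: le_class_of ext_class_of intro: g_mono)
  qed
  have "ext x \<le> path_sup (\<lambda>l. g (shrink f s l))"
    using monoD[OF m s(2)] by (simp add: ext_class_of path_cut f s)
  also have "\<dots> \<le> g (f s)"
    by (rule path_sup_least[OF IQ_mono_g[OF path_cut[OF f(1) s(1)]]])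
      (use s IQ_mult f in \<open>auto simp: shrink_def intro!: way_below_imp_le g_prec pathD\<close>)
  also have "\<dots> \<lless> g (f t)" using pathD[OF f(1) s(1) t] g_prec by blast
  also have "\<dots> \<le> ext y" using f t by (auto simp: ext_class_of intro: path_sup_upper IQ_mono_g)
  finally show "ext x \<lless> ext y" .
qed

end


section \<open>The internal hom\<close>

lemma gcu_add: "generalized_cu_morphism f \<Longrightarrow> f (a + b) = f a + f b"
  and gcu_zero: "generalized_cu_morphism f \<Longrightarrow> f 0 = 0"
  and gcu_mono: "generalized_cu_morphism f \<Longrightarrow> mono f"
  and gcu_sup: "generalized_cu_morphism f \<Longrightarrow> incseq c \<Longrightarrow> is_sup (range c) s \<Longrightarrow>
    is_sup (range (\<lambda>n. f (c n))) (f s)"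
  by (simp_all add: generalized_cu_morphism_def)

lemma cu_way_below: "cu_morphism f \<Longrightarrow> a' \<lless> a \<Longrightarrow> f a' \<lless> f a"
  and cu_gcu: "cu_morphism f \<Longrightarrow> generalized_cu_morphism f"
  by (simp_all add: cu_morphism_def)

typedef (overloaded) ('a, 'b) gcu = "{f :: 'a::cu_semigroup \<Rightarrow> 'b::cu_semigroup. generalized_cu_morphism f}"
  morphisms gcu_apply Gcu
proof
  show "(\<lambda>_. 0) \<in> {f :: 'a \<Rightarrow> 'b. generalized_cu_morphism f}"
    by (auto simp: generalized_cu_morphism_def intro: monoI is_supI)
qed

setup_lifting type_definition_gcu

instantiation gcu :: (cu_semigroup, cu_semigroup) prec_monoid
begin

lift_definition zero_gcu :: "('a, 'b) gcu" is "\<lambda>_. 0"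
  by (auto simp: generalized_cu_morphism_def intro: monoI is_supI)

lift_definition plus_gcu :: "('a, 'b) gcu \<Rightarrow> ('a, 'b) gcu \<Rightarrow> ('a, 'b) gcu" is "\<lambda>f g a. f a + g a"
proof -
  fix f g :: "'a \<Rightarrow> 'b" assume f: "generalized_cu_morphism f" and g: "generalized_cu_morphism g"
  have inc: "incseq (\<lambda>n. h (c n))" if "generalized_cu_morphism h" "incseq c" for h :: "'a \<Rightarrow> 'b" and c
    using gcu_mono[OF that(1)] that(2) by (auto simp: mono_def)
  show "generalized_cu_morphism (\<lambda>a. f a + g a)"
    unfolding generalized_cu_morphism_def
  proof (intro conjI allI impI)
    show "mono (\<lambda>a. f a + g a)"
      using gcu_mono[OF f] gcu_mono[OF g] by (auto simp: mono_def intro: add_mono)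
    show "is_sup (range (\<lambda>n. f (c n) + g (c n))) (f s + g s)" if "incseq c" "is_sup (range c) s" for c s
      by (rule O4[OF inc[OF f that(1)] inc[OF g that(1)] gcu_sup[OF f that] gcu_sup[OF g that]])
  qed (simp_all add: gcu_add[OF f] gcu_add[OF g] gcu_zero[OF f] gcu_zero[OF g] ac_simps)
qed

lift_definition prec_gcu :: "('a, 'b) gcu \<Rightarrow> ('a, 'b) gcu \<Rightarrow> bool" is
  "\<lambda>f g. \<forall>a' a. a' \<lless> a \<longrightarrow> f a' \<lless> g a" .

instance
proof
  fix a b c a' b' :: "('a, 'b) gcu"
  show "a + b + c = a + (b + c)" by transfer (simp add: ac_simps)
  show "a + b = b + a" by transfer (simp add: ac_simps)
  show "0 + a = a" by transfer simp
  show "a \<prec> c" if "a \<prec> b" "b \<prec> c"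
    using that by transfer (meson way_below_interp1 way_below_trans)
  show "a' + b' \<prec> a + b" if "a' \<prec> a" "b' \<prec> b"
    using that by transfer (auto intro: O3)
  show "0 \<prec> a" by transfer (simp add: zero_way_below)
qed

end

text \<open>
  \<^typ>\<open>('a, 'b) gcu\<close> is \<open>Cu[S, T]\<close> and \<open>ihom\<close> is \<open>[[S, T]]\<close>; \<open>endpoint\<close> is \<open>\<sigma>\<close>, and \<open>ihom_of\<close> is the
  identification of a Cu-morphism with the class of its constant path.
\<close>

type_synonym ('a, 'b) ihom = "('a, 'b) gcu path_class"

lemma prec_gcu_le:
  assumes "f \<prec> g"
  shows "gcu_apply f a \<le> gcu_apply g a"
proof -
  obtain c :: "nat \<Rightarrow> 'a" where c: "incseq c" "is_sup (range c) a" "\<And>n. c n \<lless> a"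
    using ex_approx_seq[of a] by blast
  have f: "generalized_cu_morphism (gcu_apply f)" using gcu_apply by simp
  have "gcu_apply f (c n) \<le> gcu_apply g a" for n
    using assms c(3) by (auto simp: prec_gcu.rep_eq intro!: way_below_imp_le)
  thus ?thesis using is_sup_least[OF gcu_sup[OF f c(1,2)]] by blast
qed

lemma IQ_mono_gcu: "is_path f \<Longrightarrow> IQ_mono (\<lambda>l. gcu_apply (f l) a)"
  by (auto simp: IQ_mono_def is_path_def prec_gcu_le)

lemma endpoint_le:
  assumes "is_path f" "is_path g" "f \<lesssim> g"
  shows "path_sup (\<lambda>l. gcu_apply (f l) a) \<le> path_sup (\<lambda>l. gcu_apply (g l) a)"
  by (intro path_sup_mono IQ_mono_gcu assms) (use assms(3) prec_gcu_le in \<open>unfold path_le_def, blast\<close>)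

lift_definition endpoint :: "('a::cu_semigroup, 'b::cu_semigroup) ihom \<Rightarrow> 'a \<Rightarrow> 'b" is
  "\<lambda>f a. path_sup (\<lambda>l. gcu_apply (f l) a)"
  by (auto simp: path_equiv_def intro!: ext order_antisym endpoint_le)

definition ihom_of :: "('a::cu_semigroup \<Rightarrow> 'b::cu_semigroup) \<Rightarrow> ('a, 'b) ihom" where
  "ihom_of \<phi> = class_of (\<lambda>_. Gcu \<phi>)"


section \<open>The tensor product\<close>

typedef ('a, 'b) formal_sum = "UNIV :: ('a \<times> 'b) multiset set"
  morphisms summands Formal_Sum ..

setup_lifting type_definition_formal_sum

text \<open>
  The order of the tensor product of positively ordered semigroups, as a preorder on formal sums of
  simple tensors.
\<close>

inductive tensor_preorder ::
  "('a::cu_semigroup \<times> 'b::cu_semigroup) multiset \<Rightarrow> ('a \<times> 'b) multiset \<Rightarrow> bool" (infix "\<preceq>" 50) where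
  refl: "M \<preceq> M"
| trans: "M \<preceq> N \<Longrightarrow> N \<preceq> P \<Longrightarrow> M \<preceq> P"
| add: "M \<preceq> N \<Longrightarrow> M + P \<preceq> N + P"
| mono: "a \<le> a' \<Longrightarrow> b \<le> b' \<Longrightarrow> {#(a, b)#} \<preceq> {#(a', b')#}"
| left_split: "{#(a + a', b)#} \<preceq> {#(a, b), (a', b)#}"
| left_join: "{#(a, b), (a', b)#} \<preceq> {#(a + a', b)#}"
| right_split: "{#(a, b + b')#} \<preceq> {#(a, b), (a, b')#}"
| right_join: "{#(a, b), (a, b')#} \<preceq> {#(a, b + b')#}"
| left_zero: "{#(0, b)#} \<preceq> {#}"
| zero_left: "{#} \<preceq> {#(0, b)#}"
| right_zero: "{#(a, 0)#} \<preceq> {#}"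
| zero_right: "{#} \<preceq> {#(a, 0)#}"

abbreviation pair_below :: "'a::order \<times> 'b::order \<Rightarrow> 'a \<times> 'b \<Rightarrow> bool" where
  "pair_below x y \<equiv> fst x \<lless> fst y \<and> snd x \<lless> snd y"

definition tensor_prec ::
  "('a::cu_semigroup \<times> 'b::cu_semigroup) multiset \<Rightarrow> ('a \<times> 'b) multiset \<Rightarrow> bool" where
  "tensor_prec M N \<longleftrightarrow> (\<exists>M' N'. M \<preceq> M' \<and> rel_mset pair_below M' N' \<and> N' \<preceq> N)"

lemma tensor_preorder_add: "M \<preceq> N \<Longrightarrow> M' \<preceq> N' \<Longrightarrow> M + M' \<preceq> N + N'"
  by (metis add.commute tensor_preorder.add tensor_preorder.trans)

lemma tensor_preorder_empty: "{#} \<preceq> M"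
proof (induction M)
  case (add x M)
  have "{#(0, snd x)#} \<preceq> {#(fst x, snd x)#}" by (intro tensor_preorder.mono zero_least order_refl)
  hence "{#} \<preceq> {#x#}" using tensor_preorder.zero_left tensor_preorder.trans by fastforce
  from tensor_preorder_add[OF this add.IH] show ?case by simp
qed (rule tensor_preorder.refl)

lemma rel_mset_pair_induct [consumes 1, case_names empty add]:
  assumes "rel_mset Q M N" "P {#} {#}"
    "\<And>x y M N. Q x y \<Longrightarrow> rel_mset Q M N \<Longrightarrow> P M N \<Longrightarrow> P (add_mset x M) (add_mset y N)"
  shows "P M N"
  using rel_mset_induct[of Q M N "\<lambda>R M N. R = Q \<longrightarrow> P M N"] assms by auto

lemma rel_mset_plus: "rel_mset R M N \<Longrightarrow> rel_mset R M' N' \<Longrightarrow> rel_mset R (M + M') (N + N')"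
  by (induction M N rule: rel_mset_pair_induct) (auto intro: rel_mset_Plus)

lemma rel_mset_below_le: "rel_mset pair_below M N \<Longrightarrow> M \<preceq> N"
proof (induction M N rule: rel_mset_pair_induct)
  case (add a b M N)
  have "{#(fst a, snd a)#} \<preceq> {#(fst b, snd b)#}"
    using add.hyps by (intro tensor_preorder.mono) (auto intro: way_below_imp_le)
  from tensor_preorder_add[OF this add.IH] show ?case by simp
qed (rule tensor_preorder.refl)

lemma tensor_precI: "rel_mset pair_below M N \<Longrightarrow> tensor_prec M N"
  unfolding tensor_prec_def using tensor_preorder.refl by blast

lemma tensor_prec_le: "tensor_prec M N \<Longrightarrow> M \<preceq> N"
  unfolding tensor_prec_def using tensor_preorder.trans[OF tensor_preorder.trans[OF _ rel_mset_below_le]] by blast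

lemma preorder_prec_trans: "M \<preceq> N \<Longrightarrow> tensor_prec N P \<Longrightarrow> tensor_prec M P"
  and prec_preorder_trans: "tensor_prec M N \<Longrightarrow> N \<preceq> P \<Longrightarrow> tensor_prec M P"
  unfolding tensor_prec_def by (meson tensor_preorder.trans)+

lemma tensor_prec_add:
  assumes "tensor_prec M N" "tensor_prec M' N'"
  shows "tensor_prec (M + M') (N + N')"
proof -
  obtain A B where "M \<preceq> A" "rel_mset pair_below A B" "B \<preceq> N"
    using assms(1) unfolding tensor_prec_def by blast
  moreover obtain A' B' where "M' \<preceq> A'" "rel_mset pair_below A' B'" "B' \<preceq> N'"
    using assms(2) unfolding tensor_prec_def by blast
  ultimately have "M + M' \<preceq> A + A'" "rel_mset pair_below (A + A') (B + B')" "B + B' \<preceq> N + N'"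
    by (simp_all add: tensor_preorder_add rel_mset_plus)
  thus ?thesis unfolding tensor_prec_def by blast
qed

instantiation formal_sum :: (type, type) comm_monoid_add
begin

lift_definition zero_formal_sum :: "('a, 'b) formal_sum" is "{#}" .
lift_definition plus_formal_sum :: "('a, 'b) formal_sum \<Rightarrow> ('a, 'b) formal_sum \<Rightarrow> ('a, 'b) formal_sum"
  is "(+)" .

instance by standard (transfer; simp add: ac_simps)+

end

instantiation formal_sum :: (cu_semigroup, cu_semigroup) prec_monoid
begin

lift_definition prec_formal_sum :: "('a, 'b) formal_sum \<Rightarrow> ('a, 'b) formal_sum \<Rightarrow> bool"
  is tensor_prec .

instance
proof
  fix a b c a' b' :: "('a, 'b) formal_sum"
  show "a \<prec> b \<Longrightarrow> b \<prec> c \<Longrightarrow> a \<prec> c"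
    by transfer (rule preorder_prec_trans[OF tensor_prec_le])
  show "a' \<prec> a \<Longrightarrow> b' \<prec> b \<Longrightarrow> a' + b' \<prec> a + b"
    by transfer (rule tensor_prec_add)
  show "0 \<prec> a"
    by transfer (auto simp: tensor_prec_def intro!: exI[of _ "{#}"] tensor_preorder.refl
      tensor_preorder_empty rel_mset_Zero)
qed

end

text \<open>
  The tensor product is the path completion of formal sums under \<^const>\<open>tensor_prec\<close>; the universal
  property is \<open>tensor_bimorphism\<close>, \<open>tensor_universal\<close> and \<open>tensor_morphism_le_iff\<close> below.
\<close>

type_synonym ('a, 'b) tensor = "('a, 'b) formal_sum path_class"

definition approx_path :: "(rat \<Rightarrow> 'a::cu_semigroup) \<Rightarrow> 'a \<Rightarrow> bool" where
  "approx_path p a \<longleftrightarrow> (\<forall>l\<in>IQ. \<forall>m\<in>IQ. l < m \<longrightarrow> p l \<lless> p m) \<and> is_sup (p ` IQ) a"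

definition approx :: "'a::cu_semigroup \<Rightarrow> rat \<Rightarrow> 'a" where
  "approx a = (SOME p. approx_path p a)"

text \<open>The class below does not depend on the chosen approximating paths.\<close>

definition tensor :: "'a::cu_semigroup \<Rightarrow> 'b::cu_semigroup \<Rightarrow> ('a, 'b) tensor" (infixl "\<otimes>" 70) where
  "a \<otimes> b = class_of (\<lambda>l. Formal_Sum {#(approx a l, approx b l)#})"

lemma ex_approx_path: "\<exists>p. approx_path p (a :: 'a::cu_semigroup)"
proof -
  obtain c where c: "\<And>n. c n \<lless> c (Suc n)" "is_sup (range c) a" using ex_approx_seq[of a] by blast
  obtain p where p: "\<And>l m. l \<in> IQ \<Longrightarrow> m \<in> IQ \<Longrightarrow> l < m \<Longrightarrow> p l \<lless> p m"
    "\<And>n. \<exists>l\<in>IQ. c n \<lless> p l" "\<And>l. l \<in> IQ \<Longrightarrow> \<exists>n. p l \<lless> c n"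
  proof (rule rational_chain[of way_below c])
    show "x \<lless> z" if "x \<lless> y" "y \<lless> z" for x y z :: 'a using that by (rule way_below_trans)
    show "\<exists>z. (\<forall>x\<in>L. x \<lless> z) \<and> z \<lless> u" if "finite L" "\<forall>x\<in>L. x \<lless> u" for L and u :: 'a
      using that by (rule way_below_interp)
    show "c n \<lless> c (Suc n)" for n by (rule c(1))
  qed blast
  have "is_sup (p ` IQ) a"
    by (rule is_sup_cofinal[OF c(2)]) (use p(2,3) way_below_imp_le in \<open>fast+\<close>)
  thus ?thesis using p(1) unfolding approx_path_def by blast
qed

lemma approx_path: "approx_path (approx a) a"
  unfolding approx_def using ex_approx_path by (rule someI_ex)

lemma approx_mono: "l \<in> IQ \<Longrightarrow> m \<in> IQ \<Longrightarrow> l < m \<Longrightarrow> approx a l \<lless> approx a m"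
  using approx_path unfolding approx_path_def by blast

lemma is_sup_approx: "is_sup (approx a ` IQ) a"
  using approx_path unfolding approx_path_def by blast

lemma IQ_mono_approx: "IQ_mono (approx a)"
  by (auto simp: IQ_mono_def intro: way_below_imp_le approx_mono)

lemma path_sup_approx: "path_sup (approx a) = a"
  using path_sup_eq is_sup_approx by blast

lemma is_sup_approx_tseq: "is_sup (range (\<lambda>n. approx a (tseq n))) a"
  using is_sup_tseq_iff[OF IQ_mono_approx] is_sup_approx by blast

lemma incseq_approx_tseq: "incseq (\<lambda>n. approx a (tseq n))"
  by (rule IQ_mono_tseq[OF IQ_mono_approx])

lemma approx_below: "l \<in> IQ \<Longrightarrow> approx a l \<lless> a"
  using IQ_above[of l] approx_mono[of l] way_below_le_trans is_sup_upper[OF is_sup_approx] by blast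

lemma ex_approx_above:
  assumes "x \<lless> a"
  shows "\<exists>m\<in>IQ. x \<lless> approx a m"
proof -
  obtain z where "x \<lless> z" "z \<lless> a" using assms way_below_interp1 by blast
  moreover then obtain m where "m \<in> IQ" "z \<le> approx a m"
    using way_below_path_sup[of z "approx a"] path_sup_approx IQ_mono_approx by metis
  ultimately show ?thesis using way_below_le_trans by blast
qed

lemma ex_approx_above2:
  assumes "x \<lless> a" "y \<lless> b"
  shows "\<exists>m\<in>IQ. x \<lless> approx a m \<and> y \<lless> approx b m"
proof -
  obtain m n where mn: "m \<in> IQ" "n \<in> IQ" "x \<lless> approx a m" "y \<lless> approx b n"
    using ex_approx_above assms by metis
  obtain t where "t \<in> IQ" "m < t" "n < t" using IQ_above2 mn by blast
  thus ?thesis using mn approx_mono by (meson way_below_trans)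
qed

abbreviation simple_path :: "'a::cu_semigroup \<Rightarrow> 'b::cu_semigroup \<Rightarrow> rat \<Rightarrow> ('a, 'b) formal_sum" where
  "simple_path a b \<equiv> \<lambda>l. Formal_Sum {#(approx a l, approx b l)#}"

lemma prec_Formal_Sum [simp]: "Formal_Sum M \<prec> Formal_Sum N \<longleftrightarrow> tensor_prec M N"
  by (simp add: prec_formal_sum.rep_eq Formal_Sum_inverse)

lemma plus_Formal_Sum [simp]: "Formal_Sum M + Formal_Sum N = Formal_Sum (M + N)"
  by (simp add: plus_formal_sum.abs_eq)

lemma rel_mset_single: "R x y \<Longrightarrow> rel_mset R {#x#} {#y#}"
  using rel_mset_Plus[of R x y "{#}" "{#}"] by (simp add: rel_mset_Zero)

lemma tensor_prec_single: "a' \<lless> a \<Longrightarrow> b' \<lless> b \<Longrightarrow> tensor_prec {#(a', b')#} {#(a, b)#}"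
  by (rule tensor_precI, rule rel_mset_single) simp

lemma path_simple: "is_path (simple_path a b)"
  by (auto simp: is_path_def intro!: tensor_prec_single approx_mono)

lemma tensor_mono:
  assumes "a \<le> a'" "b \<le> b'"
  shows "a \<otimes> b \<le> a' \<otimes> b'"
  unfolding tensor_def
proof (subst le_class_of[OF path_simple path_simple], unfold path_le_def, intro ballI)
  fix l assume "l \<in> IQ"
  hence "approx a l \<lless> a'" "approx b l \<lless> b'" using approx_below assms way_below_le_trans by blast+
  then obtain m where "m \<in> IQ" "approx a l \<lless> approx a' m" "approx b l \<lless> approx b' m"
    using ex_approx_above2 by blast
  thus "\<exists>m\<in>IQ. simple_path a b l \<prec> simple_path a' b' m" 
    by (intro bexI[of _ m]) (simp_all add: tensor_prec_single)
qed

lemma ex_approx_add: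
  assumes "x \<lless> a + a'"
  shows "\<exists>m\<in>IQ. x \<le> approx a m + approx a' m"
proof (rule way_below_path_sup)
  show "x \<lless> path_sup (\<lambda>l. approx a l + approx a' l)"
    using assms by (simp add: path_sup_add IQ_mono_approx path_sup_approx)
  show "IQ_mono (\<lambda>l. approx a l + approx a' l)"
    using IQ_mono_approx[of a] IQ_mono_approx[of a'] by (auto simp: IQ_mono_def intro: add_mono)
qed

lemma tensor_add_left: "(a + a') \<otimes> b = a \<otimes> b + a' \<otimes> b"
proof -
  have "simple_path (a + a') b \<lesssim> (\<lambda>l. simple_path a b l + simple_path a' b l)"
    unfolding path_le_def
  proof
    fix l assume l: "l \<in> IQ"
    obtain z where z: "approx (a + a') l \<lless> z" "z \<lless> a + a'" using approx_below[OF l] way_below_interp1 by blast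
    obtain m where m: "m \<in> IQ" "z \<le> approx a m + approx a' m" using ex_approx_add z by blast
    obtain t where t: "t \<in> IQ" "m < t" "l < t" using IQ_above2 m(1) l by blast
    have "z \<le> approx a t + approx a' t"
      using m(2) add_mono[of "approx a m" "approx a t" "approx a' m" "approx a' t"]
        approx_mono[OF m(1) t(1,2)] way_below_imp_le order_trans by blast
    hence "tensor_prec {#(approx (a + a') l, approx b l)#} {#(approx a t + approx a' t, approx b t)#}"
      using z(1) way_below_le_trans approx_mono l t by (intro tensor_prec_single) blast+
    hence "tensor_prec {#(approx (a + a') l, approx b l)#} {#(approx a t, approx b t), (approx a' t, approx b t)#}"
      using prec_preorder_trans tensor_preorder.left_split by blast
    thus "\<exists>m\<in>IQ. simple_path (a + a') b l \<prec> simple_path a b m + simple_path a' b m"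
      using t(1) by (auto simp: add_mset_commute)
  qed
  moreover have "(\<lambda>l. simple_path a b l + simple_path a' b l) \<lesssim> simple_path (a + a') b"
    unfolding path_le_def
  proof
    fix l assume l: "l \<in> IQ"
    obtain m where m: "m \<in> IQ" "approx a l + approx a' l \<lless> approx (a + a') m" "approx b l \<lless> approx b m"
      using ex_approx_above2[of _ "a + a'" _ b] approx_below[OF l] O3 by metis
    have "tensor_prec {#(approx a l, approx b l), (approx a' l, approx b l)#} {#(approx (a + a') m, approx b m)#}"
      using preorder_prec_trans tensor_preorder.left_join tensor_prec_single m(2,3) by blast
    thus "\<exists>m\<in>IQ. simple_path a b l + simple_path a' b l \<prec> simple_path (a + a') b m"
      using m(1) by (auto simp: add_mset_commute)
  qed
  ultimately have "class_of (simple_path (a + a') b) = class_of (\<lambda>l. simple_path a b l + simple_path a' b l)"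
    by (intro order_antisym) (simp_all only: le_class_of path_simple path_add)
  thus ?thesis by (simp only: tensor_def plus_class_of path_simple)
qed

lemma tensor_add_right: "b \<otimes> (a + a') = b \<otimes> a + b \<otimes> a'"
proof -
  have "simple_path b (a + a') \<lesssim> (\<lambda>l. simple_path b a l + simple_path b a' l)"
    unfolding path_le_def
  proof
    fix l assume l: "l \<in> IQ"
    obtain z where z: "approx (a + a') l \<lless> z" "z \<lless> a + a'" using approx_below[OF l] way_below_interp1 by blast
    obtain m where m: "m \<in> IQ" "z \<le> approx a m + approx a' m" using ex_approx_add z by blast
    obtain t where t: "t \<in> IQ" "m < t" "l < t" using IQ_above2 m(1) l by blast
    have "z \<le> approx a t + approx a' t"
      using m(2) add_mono[of "approx a m" "approx a t" "approx a' m" "approx a' t"]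
        approx_mono[OF m(1) t(1,2)] way_below_imp_le order_trans by blast
    hence "tensor_prec {#(approx b l, approx (a + a') l)#} {#(approx b t, approx a t + approx a' t)#}"
      using z(1) way_below_le_trans approx_mono l t by (intro tensor_prec_single) blast+
    hence "tensor_prec {#(approx b l, approx (a + a') l)#} {#(approx b t, approx a t), (approx b t, approx a' t)#}"
      using prec_preorder_trans tensor_preorder.right_split by blast
    thus "\<exists>m\<in>IQ. simple_path b (a + a') l \<prec> simple_path b a m + simple_path b a' m"
      using t(1) by (auto simp: add_mset_commute)
  qed
  moreover have "(\<lambda>l. simple_path b a l + simple_path b a' l) \<lesssim> simple_path b (a + a')"
    unfolding path_le_def
  proof
    fix l assume l: "l \<in> IQ"
    obtain m where m: "m \<in> IQ" "approx a l + approx a' l \<lless> approx (a + a') m" "approx b l \<lless> approx b m"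
      using ex_approx_above2[of _ "a + a'" _ b] approx_below[OF l] O3 by metis
    have "tensor_prec {#(approx b l, approx a l), (approx b l, approx a' l)#} {#(approx b m, approx (a + a') m)#}"
      using preorder_prec_trans tensor_preorder.right_join tensor_prec_single m(2,3) by blast
    thus "\<exists>m\<in>IQ. simple_path b a l + simple_path b a' l \<prec> simple_path b (a + a') m"
      using m(1) by (auto simp: add_mset_commute)
  qed
  ultimately have "class_of (simple_path b (a + a')) = class_of (\<lambda>l. simple_path b a l + simple_path b a' l)"
    by (intro order_antisym) (simp_all only: le_class_of path_simple path_add)
  thus ?thesis by (simp only: tensor_def plus_class_of path_simple)
qed


lemma tensor_zero_left: "(0 :: 'a::cu_semigroup) \<otimes> (b :: 'b::cu_semigroup) = 0"
proof (rule order_antisym)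
  have "tensor_prec {#(approx (0 :: 'a) l, approx b l)#} {#}" if l: "l \<in> IQ" for l
  proof -
    have "approx 0 l = (0 :: 'a)" using approx_below[OF l] way_below_imp_le zero_least order_antisym by blast
    hence "{#(approx (0 :: 'a) l, approx b l)#} \<preceq> {#}" using tensor_preorder.left_zero by simp
    thus ?thesis by (rule preorder_prec_trans) (simp add: tensor_precI)
  qed
  hence "simple_path (0 :: 'a) b \<lesssim> (\<lambda>_. 0 :: ('a, 'b) formal_sum)"
    unfolding path_le_def using IQ_nonempty by (auto simp: zero_formal_sum.abs_eq)
  thus "(0 :: 'a) \<otimes> b \<le> 0"
    unfolding tensor_def zero_path_class.abs_eq by (simp add: le_class_of path_simple path_zero)
qed (rule zero_least)

lemma tensor_zero_right: "(b :: 'a::cu_semigroup) \<otimes> (0 :: 'b::cu_semigroup) = 0"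
proof (rule order_antisym)
  have "tensor_prec {#(approx b l, approx (0 :: 'b) l)#} {#}" if l: "l \<in> IQ" for l
  proof -
    have "approx 0 l = (0 :: 'b)" using approx_below[OF l] way_below_imp_le zero_least order_antisym by blast
    hence "{#(approx b l, approx (0 :: 'b) l)#} \<preceq> {#}" using tensor_preorder.right_zero by simp
    thus ?thesis by (rule preorder_prec_trans) (simp add: tensor_precI)
  qed
  hence "simple_path b (0 :: 'b) \<lesssim> (\<lambda>_. 0 :: ('a, 'b) formal_sum)"
    unfolding path_le_def using IQ_nonempty by (auto simp: zero_formal_sum.abs_eq)
  thus "b \<otimes> (0 :: 'b) \<le> 0"
    unfolding tensor_def zero_path_class.abs_eq by (simp add: le_class_of path_simple path_zero)
qed (rule zero_least)

lemma tensor_sup: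
  assumes c: "incseq c" "is_sup (range c) s" and d: "incseq d" "is_sup (range d) t"
  shows "is_sup (range (\<lambda>n. c n \<otimes> d n)) (s \<otimes> t)"
  unfolding tensor_def
proof (rule is_sup_class_of)
  show "simple_path (c n) (d n) \<lesssim> simple_path s t" for n
    using tensor_mono[of "c n" s "d n" t] is_sup_upper[OF c(2)] is_sup_upper[OF d(2)]
    by (simp add: tensor_def le_class_of path_simple)
  fix l assume l: "l \<in> IQ"
  obtain m where m: "m \<in> IQ" "l < m" using IQ_above l by blast
  obtain j k where jk: "approx s m \<le> c j" "approx t m \<le> d k"
    using way_belowD[OF approx_below[OF m(1)] c order_refl] way_belowD[OF approx_below[OF m(1)] d order_refl] by blast
  define n where "n = max j k"
  have "c j \<le> c n" "d k \<le> d n" using c(1) d(1) by (auto simp: n_def intro: monoD)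
  hence "approx s l \<lless> c n" "approx t l \<lless> d n"
    using approx_mono[OF l m] jk way_below_le_trans by (meson order_trans)+
  then obtain r where "r \<in> IQ" "approx s l \<lless> approx (c n) r" "approx t l \<lless> approx (d n) r"
    using ex_approx_above2 by blast
  thus "\<exists>n. \<exists>m\<in>IQ. simple_path s t l \<prec> simple_path (c n) (d n) m"
    by (intro exI[of _ n] bexI[of _ r]) (simp_all add: tensor_prec_single)
qed (rule path_simple)+

lemma tensor_way_below:
  assumes "a' \<lless> a" "b' \<lless> b"
  shows "a' \<otimes> b' \<lless> a \<otimes> b"
proof -
  obtain m where m: "m \<in> IQ" "a' \<lless> approx a m" "b' \<lless> approx b m" using ex_approx_above2 assms by blast
  obtain s where s: "s \<in> IQ" "m < s" using IQ_above m(1) by blast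
  have ms: "m / s \<in> IQ" "m / s * s = m" using m(1) s by (auto simp: IQ_def)
  have "simple_path a' b' \<lesssim> shrink (simple_path a b) s"
    unfolding path_le_def
  proof
    fix l assume "l \<in> IQ"
    hence "approx a' l \<lless> approx a m" "approx b' l \<lless> approx b m"
      using m(2,3) approx_below way_below_trans by meson+
    thus "\<exists>m\<in>IQ. simple_path a' b' l \<prec> shrink (simple_path a b) s m"
      using ms by (intro bexI[of _ "m / s"]) (simp_all add: shrink_def tensor_prec_single)
  qed
  hence "a' \<otimes> b' \<le> class_of (shrink (simple_path a b) s)"
    unfolding tensor_def by (simp add: le_class_of path_simple path_cut s)
  also have "\<dots> \<lless> a \<otimes> b" unfolding tensor_def by (rule cut_way_below[OF path_simple s(1)])
  finally show ?thesis .
qed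

lemma tensor_bimorphism: "cu_bimorphism (\<otimes>)"
  unfolding cu_bimorphism_def
  by (auto simp: tensor_add_left tensor_add_right tensor_zero_left tensor_zero_right
    intro: monoI tensor_mono tensor_sup tensor_way_below)


subsection \<open>Universal property\<close>

definition sum_extension ::
  "('a \<Rightarrow> 'b \<Rightarrow> 'c::cu_semigroup) \<Rightarrow> ('a \<times> 'b) multiset \<Rightarrow> 'c" where
  "sum_extension \<phi> M = (\<Sum>(a, b)\<in>#M. \<phi> a b)"

lemma sum_extension_simps [simp]:
  "sum_extension \<phi> {#} = 0"
  "sum_extension \<phi> (add_mset x M) = \<phi> (fst x) (snd x) + sum_extension \<phi> M"
  "sum_extension \<phi> (M + N) = sum_extension \<phi> M + sum_extension \<phi> N"
  by (auto simp: sum_extension_def split_def)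

lemma sum_extension_mono:
  assumes "M \<preceq> N" "cu_bimorphism \<phi>"
  shows "sum_extension \<phi> M \<le> sum_extension \<phi> N"
  using assms(1)
proof induction
  case (mono a a' b b')
  have "mono (\<lambda>a. \<phi> a b)" "mono (\<phi> a')" using assms(2) unfolding cu_bimorphism_def by blast+
  hence "\<phi> a b \<le> \<phi> a' b'" using mono by (meson monoD order_trans)
  thus ?case by simp
qed (use assms(2) in \<open>auto simp: cu_bimorphism_def ac_simps intro: add_right_mono add_left_mono\<close>)

lemma sum_extension_way_below:
  assumes "tensor_prec M N" "cu_bimorphism \<phi>"
  shows "sum_extension \<phi> M \<lless> sum_extension \<phi> N"
proof -
  obtain M' N' where MN: "M \<preceq> M'" "rel_mset pair_below M' N'" "N' \<preceq> N"
    using assms(1) unfolding tensor_prec_def by blast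
  have "sum_extension \<phi> M' \<lless> sum_extension \<phi> N'"
    using MN(2)
  proof (induction rule: rel_mset_pair_induct)
    case (add x y M N)
    have "\<phi> (fst x) (snd x) \<lless> \<phi> (fst y) (snd y)" using add.hyps assms(2) unfolding cu_bimorphism_def by blast
    thus ?case using add.IH by (simp add: O3)
  qed (simp add: zero_way_below)
  thus ?thesis using way_below_mono sum_extension_mono[OF MN(1) assms(2)] sum_extension_mono[OF MN(3) assms(2)] by blast
qed

lemma cu_bimorphism_sup:
  "cu_bimorphism \<phi> \<Longrightarrow> incseq c \<Longrightarrow> incseq d \<Longrightarrow> is_sup (range c) s \<Longrightarrow> is_sup (range d) t
    \<Longrightarrow> is_sup (range (\<lambda>k. \<phi> (c k) (d k))) (\<phi> s t)"
  unfolding cu_bimorphism_def by blast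

lemma tensor_lift_exists:
  fixes \<phi> :: "'a::cu_semigroup \<Rightarrow> 'b::cu_semigroup \<Rightarrow> 'c::cu_semigroup"
  assumes \<phi>: "cu_bimorphism \<phi>"
  shows "\<exists>h. cu_morphism h \<and> (\<forall>a b. h (a \<otimes> b) = \<phi> a b)"
proof -
  interpret prec_map "\<lambda>x. sum_extension \<phi> (summands x)"
    by standard (simp_all add: plus_formal_sum.rep_eq zero_formal_sum.rep_eq prec_formal_sum.rep_eq
      sum_extension_way_below \<phi>)
  have "ext (a \<otimes> b) = \<phi> a b" for a b
  proof -
    have eq: "ext (a \<otimes> b) = path_sup (\<lambda>l. \<phi> (approx a l) (approx b l))"
      unfolding tensor_def by (simp add: ext_class_of path_simple Formal_Sum_inverse)
    have m: "IQ_mono (\<lambda>l. \<phi> (approx a l) (approx b l))"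
      using IQ_mono_g[OF path_simple[of a b]] by (simp add: Formal_Sum_inverse)
    have "is_sup (range (\<lambda>n. \<phi> (approx a (tseq n)) (approx b (tseq n)))) (\<phi> a b)"
      by (rule cu_bimorphism_sup[OF \<phi> incseq_approx_tseq incseq_approx_tseq is_sup_approx_tseq is_sup_approx_tseq])
    from path_sup_eq[OF iffD1[OF is_sup_tseq_iff[OF m] this]] show ?thesis unfolding eq .
  qed
  thus ?thesis using cu_morphism_ext by blast
qed

definition approx_sum :: "('a::cu_semigroup \<times> 'b::cu_semigroup) multiset \<Rightarrow> rat \<Rightarrow> ('a \<times> 'b) multiset" where
  "approx_sum M l = image_mset (\<lambda>(a, b). (approx a l, approx b l)) M"

lemma rel_mset_approx_sum: "l \<in> IQ \<Longrightarrow> rel_mset pair_below (approx_sum M l) M"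
  by (induction M) (auto simp: approx_sum_def rel_mset_Zero intro!: rel_mset_Plus approx_below)

lemma path_approx_sum: "is_path (\<lambda>l. Formal_Sum (approx_sum M l))"
proof -
  have "rel_mset pair_below (approx_sum M l) (approx_sum M m)" if "l \<in> IQ" "m \<in> IQ" "l < m" for l m
    by (induction M) (auto simp: approx_sum_def rel_mset_Zero intro!: rel_mset_Plus approx_mono that)
  thus ?thesis by (auto simp: is_path_def intro: tensor_precI)
qed

lemma class_of_approx_sum: "class_of (\<lambda>l. Formal_Sum (approx_sum M l)) = sum_extension (\<otimes>) M"
proof (induction M)
  case empty
  thus ?case by (simp add: approx_sum_def zero_path_class.abs_eq zero_formal_sum.abs_eq)
next
  case (add x M)
  have "class_of (\<lambda>l. Formal_Sum (approx_sum (add_mset x M) l)) =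
    class_of (\<lambda>l. simple_path (fst x) (snd x) l + Formal_Sum (approx_sum M l))"
    by (simp add: approx_sum_def split_def)
  also have "\<dots> = fst x \<otimes> snd x + class_of (\<lambda>l. Formal_Sum (approx_sum M l))"
    unfolding tensor_def by (simp only: plus_class_of path_simple path_approx_sum)
  finally show ?case using add by simp
qed

lemma rel_mset_approx_above:
  assumes "rel_mset pair_below M N"
  shows "\<exists>m\<in>IQ. \<forall>t\<in>IQ. m < t \<longrightarrow> rel_mset pair_below M (approx_sum N t)"
  using assms
proof (induction rule: rel_mset_pair_induct)
  case empty
  thus ?case using IQ_nonempty by (auto simp: approx_sum_def rel_mset_Zero)
next
  case (add x y M N)
  obtain m where m: "m \<in> IQ" "\<And>t. t \<in> IQ \<Longrightarrow> m < t \<Longrightarrow> rel_mset pair_below M (approx_sum N t)"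
    using add.IH by blast
  obtain n where n: "n \<in> IQ" "fst x \<lless> approx (fst y) n" "snd x \<lless> approx (snd y) n"
    using ex_approx_above2 add.hyps by blast
  obtain r where r: "r \<in> IQ" "m < r" "n < r" using IQ_above2 m n by blast
  have "rel_mset pair_below (add_mset x M) (approx_sum (add_mset y N) t)" if t: "t \<in> IQ" "r < t" for t
  proof -
    have "n < t" "m < t" using r t by auto
    hence "pair_below x (approx (fst y) t, approx (snd y) t)"
      using way_below_trans[OF n(2) approx_mono[OF n(1) t(1)]] way_below_trans[OF n(3) approx_mono[OF n(1) t(1)]]
      by simp
    thus ?thesis using m(2)[OF t(1) \<open>m < t\<close>] by (auto simp: approx_sum_def split_def intro: rel_mset_Plus)
  qed
  thus ?case using r(1) by blast
qed

lemma is_sup_tensor_sums: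
  fixes f :: "rat \<Rightarrow> ('a::cu_semigroup, 'b::cu_semigroup) formal_sum"
  assumes f: "is_path f"
  shows "is_sup (range (\<lambda>n. sum_extension (\<otimes>) (summands (f (tseq n))))) (class_of f)"
  unfolding class_of_approx_sum[symmetric]
proof (rule is_sup_class_of[OF path_approx_sum f])
  have f_eq: "f l = Formal_Sum (summands (f l))" for l by (simp add: summands_inverse)
  fix n show "(\<lambda>l. Formal_Sum (approx_sum (summands (f (tseq n))) l)) \<lesssim> f"
    unfolding path_le_def
  proof
    fix l assume "l \<in> IQ"
    hence "Formal_Sum (approx_sum (summands (f (tseq n))) l) \<prec> f (tseq n)"
      by (subst (2) f_eq) (auto intro: tensor_precI rel_mset_approx_sum)
    thus "\<exists>m\<in>IQ. Formal_Sum (approx_sum (summands (f (tseq n))) l) \<prec> f m" using tseq_IQ by blast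
  qed
next
  fix l assume "l \<in> IQ"
  obtain n where n: "l < tseq n" using tseq_cofinal \<open>l \<in> IQ\<close> by blast
  hence "tensor_prec (summands (f l)) (summands (f (tseq n)))"
    using pathD[OF f \<open>l \<in> IQ\<close> tseq_IQ] by (simp add: prec_formal_sum.rep_eq)
  then obtain M N where MN: "summands (f l) \<preceq> M" "rel_mset pair_below M N" "N \<preceq> summands (f (tseq n))"
    unfolding tensor_prec_def by blast
  obtain m where m: "m \<in> IQ" "\<forall>t\<in>IQ. m < t \<longrightarrow> rel_mset pair_below M (approx_sum N t)"
    using rel_mset_approx_above[OF MN(2)] by blast
  then obtain t where t: "t \<in> IQ" "rel_mset pair_below M (approx_sum N t)" using IQ_above by blast
  have "(\<lambda>l. Formal_Sum (approx_sum N l)) \<lesssim> (\<lambda>l. Formal_Sum (approx_sum (summands (f (tseq n))) l))"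
    using sum_extension_mono[OF MN(3) tensor_bimorphism]
    by (simp add: class_of_approx_sum[symmetric] le_class_of path_approx_sum)
  then obtain r where r: "r \<in> IQ" "tensor_prec (approx_sum N t) (approx_sum (summands (f (tseq n))) r)"
    using t(1) unfolding path_le_def by auto
  have "summands (f l) \<preceq> approx_sum N t" using MN(1) rel_mset_below_le[OF t(2)] by (rule tensor_preorder.trans)
  hence "f l \<prec> Formal_Sum (approx_sum (summands (f (tseq n))) r)"
    using preorder_prec_trans r(2) by (auto simp: prec_formal_sum.rep_eq Formal_Sum_inverse)
  thus "\<exists>n. \<exists>m\<in>IQ. f l \<prec> Formal_Sum (approx_sum (summands (f (tseq n))) m)" using r(1) by blast
qed

lemma incseq_tensor_sums:
  fixes f :: "rat \<Rightarrow> ('a::cu_semigroup, 'b::cu_semigroup) formal_sum"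
  assumes "is_path f"
  shows "incseq (\<lambda>n. sum_extension (\<otimes>) (summands (f (tseq n))))"
proof (rule incseq_SucI)
  fix n
  have "tensor_prec (summands (f (tseq n))) (summands (f (tseq (Suc n))))"
    using pathD[OF assms tseq_IQ tseq_IQ tseq_less[of n "Suc n"]] by (simp add: prec_formal_sum.rep_eq)
  thus "sum_extension (\<otimes>) (summands (f (tseq n))) \<le> sum_extension (\<otimes>) (summands (f (tseq (Suc n))))"
    by (intro sum_extension_mono tensor_prec_le tensor_bimorphism)
qed

lemma gcu_sum_extension:
  assumes "generalized_cu_morphism h"
  shows "h (sum_extension \<phi> M) = sum_extension (\<lambda>a b. h (\<phi> a b)) M"
  by (induction M) (auto simp: gcu_add[OF assms] gcu_zero[OF assms])

lemma tensor_morphism_le_iff: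
  fixes g h :: "('a::cu_semigroup, 'b::cu_semigroup) tensor \<Rightarrow> 'c::cu_semigroup"
  assumes "cu_morphism g" "cu_morphism h"
  shows "(\<forall>x. g x \<le> h x) \<longleftrightarrow> (\<forall>a b. g (a \<otimes> b) \<le> h (a \<otimes> b))"
proof (intro iffI allI)
  fix x :: "('a, 'b) tensor" assume gh: "\<forall>a b. g (a \<otimes> b) \<le> h (a \<otimes> b)"
  obtain f :: "rat \<Rightarrow> ('a, 'b) formal_sum" where f: "is_path f" "x = class_of f" using class_of_cases by blast
  let ?s = "\<lambda>n. sum_extension (\<otimes>) (summands (f (tseq n)))"
  have g: "generalized_cu_morphism g" and h: "generalized_cu_morphism h" using assms cu_gcu by blast+
  have "g (sum_extension (\<otimes>) M) \<le> h (sum_extension (\<otimes>) M)" for M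
    unfolding gcu_sum_extension[OF g] gcu_sum_extension[OF h]
    by (induction M) (use gh in \<open>auto intro: add_mono\<close>)
  moreover have "h (?s n) \<le> h x" for n
    using monoD[OF gcu_mono[OF h]] is_sup_upper[OF is_sup_tensor_sums[OF f(1)]] f(2) by blast
  ultimately have "g (?s n) \<le> h x" for n using order_trans by blast
  thus "g x \<le> h x"
    using is_sup_least[OF gcu_sup[OF g incseq_tensor_sums[OF f(1)] is_sup_tensor_sums[OF f(1)]]]
    unfolding f(2) by blast
qed auto

lemma tensor_universal:
  fixes \<phi> :: "'a::cu_semigroup \<Rightarrow> 'b::cu_semigroup \<Rightarrow> 'c::cu_semigroup"
  assumes "cu_bimorphism \<phi>"
  shows "\<exists>!h. cu_morphism h \<and> (\<forall>a b. h (a \<otimes> b) = \<phi> a b)"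
proof (rule ex_ex1I)
  fix g h assume "cu_morphism g \<and> (\<forall>a b. g (a \<otimes> b) = \<phi> a b)" "cu_morphism h \<and> (\<forall>a b. h (a \<otimes> b) = \<phi> a b)"
  thus "g = h"
    using tensor_morphism_le_iff[of g h] tensor_morphism_le_iff[of h g] by (auto intro!: ext order_antisym)
qed (rule tensor_lift_exists[OF assms])


definition tensor_lift ::
  "('a::cu_semigroup \<Rightarrow> 'b::cu_semigroup \<Rightarrow> 'c::cu_semigroup) \<Rightarrow> ('a, 'b) tensor \<Rightarrow> 'c" where
  "tensor_lift \<phi> = (THE h. cu_morphism h \<and> (\<forall>a b. h (a \<otimes> b) = \<phi> a b))"

lemma tensor_lift:
  assumes "cu_bimorphism \<phi>"
  shows "cu_morphism (tensor_lift \<phi>)" "tensor_lift \<phi> (a \<otimes> b) = \<phi> a b"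
  using theI'[OF tensor_universal[OF assms]] unfolding tensor_lift_def by blast+

definition tensor_map ::
  "('a::cu_semigroup \<Rightarrow> 'c::cu_semigroup) \<Rightarrow> ('b::cu_semigroup \<Rightarrow> 'd::cu_semigroup)
    \<Rightarrow> ('a, 'b) tensor \<Rightarrow> ('c, 'd) tensor" where
  "tensor_map f g = tensor_lift (\<lambda>a b. f a \<otimes> g b)"

definition tensor_assoc ::
  "(('a::cu_semigroup, 'b::cu_semigroup) tensor, 'c::cu_semigroup) tensor
    \<Rightarrow> ('a, ('b, 'c) tensor) tensor" where
  "tensor_assoc = (THE h. cu_morphism h \<and> (\<forall>a b c. h ((a \<otimes> b) \<otimes> c) = a \<otimes> (b \<otimes> c)))"


section \<open>Evaluation, composition product and the left regular map\<close>

text \<open>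
  \<open>hom_transpose\<close> is the map from Cu-morphisms \<open>S \<rightarrow> [[T, P]]\<close> to Cu-morphisms \<open>S \<otimes> T \<rightarrow> P\<close> underlying the
  bijection between the two, and \<open>hom_adjoint\<close> is its inverse.
\<close>

definition hom_transpose ::
  "('a::cu_semigroup \<Rightarrow> ('b::cu_semigroup, 'c::cu_semigroup) ihom) \<Rightarrow> ('a, 'b) tensor \<Rightarrow> 'c" where
  "hom_transpose \<alpha> = tensor_lift (\<lambda>a b. endpoint (\<alpha> a) b)"

definition hom_adjoint ::
  "(('a::cu_semigroup, 'b::cu_semigroup) tensor \<Rightarrow> 'c::cu_semigroup) \<Rightarrow> 'a \<Rightarrow> ('b, 'c) ihom" where
  "hom_adjoint h = (THE \<alpha>. cu_morphism \<alpha> \<and> hom_transpose \<alpha> = h)"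

definition eval_map :: "(('a::cu_semigroup, 'b::cu_semigroup) ihom, 'a) tensor \<Rightarrow> 'b" where
  "eval_map = hom_transpose id"

definition comp_map ::
  "(('b::cu_semigroup, 'c::cu_semigroup) ihom, ('a::cu_semigroup, 'b) ihom) tensor \<Rightarrow> ('a, 'c) ihom" where
  "comp_map = hom_adjoint (eval_map \<circ> tensor_map id eval_map \<circ> tensor_assoc)"

definition comp_product ::
  "('b::cu_semigroup, 'c::cu_semigroup) ihom \<Rightarrow> ('a::cu_semigroup, 'b) ihom \<Rightarrow> ('a, 'c) ihom"
  (infixl "\<odot>" 70) where
  "y \<odot> x = comp_map (y \<otimes> x)"

definition mult_map :: "('r::cu_semiring, 'r) tensor \<Rightarrow> 'r" where
  "mult_map = tensor_lift (\<lambda>r s. r * s)"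

definition pi_map :: "'r::cu_semiring \<Rightarrow> ('r, 'r) ihom" where
  "pi_map = hom_adjoint mult_map"

end

theory Submission
  imports Defs
begin

text \<open>
  A Cu-morphism into an internal hom is determined by its endpoints. Both \<open>r \<otimes> s \<mapsto> \<pi>(rs)\<close> and
  \<open>r \<otimes> s \<mapsto> \<pi>(r) \<circ> \<pi>(s)\<close> are Cu-morphisms, and their endpoints at \<open>t\<close> are \<open>(rs)t\<close> and \<open>r(st)\<close>. Two
  compact elements of an internal hom with the same endpoint are equal; if \<open>1\<close> is compact, this applies
  to \<open>\<pi>(1)\<close> and the identity.
\<close>

subsection \<open>Morphisms and bimorphisms\<close>

lemma gcu_apply_gcu: "generalized_cu_morphism (gcu_apply f)"
  using gcu_apply by simp

lemma gcu_monoD: "generalized_cu_morphism f \<Longrightarrow> a \<le> b \<Longrightarrow> f a \<le> f b"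
  by (rule monoD[OF gcu_mono])

lemma incseq_gcu: "generalized_cu_morphism f \<Longrightarrow> incseq c \<Longrightarrow> incseq (\<lambda>n. f (c n))"
  by (auto simp: mono_def intro: gcu_monoD)

lemma cu_morphism_comp:
  assumes "cu_morphism g" "cu_morphism f"
  shows "cu_morphism (\<lambda>a. g (f a))"
  using assms unfolding cu_morphism_def generalized_cu_morphism_def
  by (auto simp: mono_def)

lemma cu_morphism_id: "cu_morphism (\<lambda>a. a)"
  by (auto simp: cu_morphism_def generalized_cu_morphism_def mono_def)

lemma gcu_comp:
  assumes "generalized_cu_morphism g" "generalized_cu_morphism f"
  shows "generalized_cu_morphism (g \<circ> f)"
  using assms unfolding generalized_cu_morphism_def by (auto simp: mono_def)

lemma cu_bimorphism_add_left: "cu_bimorphism \<phi> \<Longrightarrow> \<phi> (a + a') b = \<phi> a b + \<phi> a' b"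
  and cu_bimorphism_zero_left: "cu_bimorphism \<phi> \<Longrightarrow> \<phi> 0 b = 0"
  and cu_bimorphism_way_below: "cu_bimorphism \<phi> \<Longrightarrow> a' \<lless> a \<Longrightarrow> b' \<lless> b \<Longrightarrow> \<phi> a' b' \<lless> \<phi> a b"
  unfolding cu_bimorphism_def by blast+

lemma cu_bimorphism_mono:
  assumes "cu_bimorphism \<phi>" "a \<le> a'" "b \<le> b'"
  shows "\<phi> a b \<le> \<phi> a' b'"
proof -
  have "mono (\<lambda>a. \<phi> a b)" "mono (\<phi> a')" using assms(1) unfolding cu_bimorphism_def by blast+
  thus ?thesis using assms(2,3) by (meson monoD order_trans)
qed

lemma is_sup_const: "is_sup (range (\<lambda>_::nat. a)) a"
  by (auto intro: is_supI)

lemma incseq_const_fun: "incseq (\<lambda>_. a)"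
  by (simp add: mono_def)

text \<open>Joint continuity is applied to a constant sequence in the first variable. The slice need
  not preserve \<open>\<lless>\<close>, since \<open>a \<lless> a\<close> may fail; hence it is only
  a generalized morphism.\<close>

lemma cu_bimorphism_gcu_right:
  fixes \<phi> :: "'a::cu_semigroup \<Rightarrow> 'b::cu_semigroup \<Rightarrow> 'c::cu_semigroup"
  assumes "cu_bimorphism \<phi>"
  shows "generalized_cu_morphism (\<phi> a)"
  unfolding generalized_cu_morphism_def
proof (intro conjI allI impI)
  fix c :: "nat \<Rightarrow> 'b" and s assume "incseq c" "is_sup (range c) s"
  thus "is_sup (range (\<lambda>n. \<phi> a (c n))) (\<phi> a s)"
    by (rule cu_bimorphism_sup[OF assms incseq_const_fun _ is_sup_const])
qed (use assms in \<open>simp_all add: cu_bimorphism_def\<close>)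

lemma cu_bimorphism_gcu_left:
  fixes \<phi> :: "'a::cu_semigroup \<Rightarrow> 'b::cu_semigroup \<Rightarrow> 'c::cu_semigroup"
  assumes "cu_bimorphism \<phi>"
  shows "generalized_cu_morphism (\<lambda>a. \<phi> a b)"
  unfolding generalized_cu_morphism_def
proof (intro conjI allI impI)
  fix c :: "nat \<Rightarrow> 'a" and s assume "incseq c" "is_sup (range c) s"
  thus "is_sup (range (\<lambda>n. \<phi> (c n) b)) (\<phi> s b)"
    by (rule cu_bimorphism_sup[OF assms _ incseq_const_fun _ is_sup_const])
qed (use assms in \<open>simp_all add: cu_bimorphism_def\<close>)

text \<open>With identities in one or two of the three slots, this supplies the bimorphisms behind
  transposition in both directions, \<open>tensor_map\<close> and the associator.\<close>

lemma cu_bimorphism_comp: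
  assumes \<phi>: "cu_bimorphism \<phi>" and f: "cu_morphism f" and g: "cu_morphism g" and h: "cu_morphism h"
  shows "cu_bimorphism (\<lambda>a b. h (\<phi> (f a) (g b)))"
proof -
  note gcu = cu_gcu[OF f] cu_gcu[OF g] cu_gcu[OF h]
  have inc: "incseq (\<lambda>k. \<phi> (c k) (d k))" if "incseq c" "incseq d" for c d
    using that by (auto simp: mono_def intro: cu_bimorphism_mono[OF \<phi>])
  have sup: "is_sup (range (\<lambda>k. h (\<phi> (f (c k)) (g (d k))))) (h (\<phi> (f s) (g t)))"
    if "incseq c" "incseq d" "is_sup (range c) s" "is_sup (range d) t" for c d s t
  proof -
    note c = incseq_gcu[OF gcu(1) that(1)] gcu_sup[OF gcu(1) that(1,3)]
    note d = incseq_gcu[OF gcu(2) that(2)] gcu_sup[OF gcu(2) that(2,4)]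
    show ?thesis
      by (rule gcu_sup[OF gcu(3) inc[OF c(1) d(1)] cu_bimorphism_sup[OF \<phi> c(1) d(1) c(2) d(2)]])
  qed
  have zero: "\<phi> a 0 = 0" "\<phi> 0 b = 0" for a b using \<phi> unfolding cu_bimorphism_def by blast+
  have add: "\<phi> a (b + b') = \<phi> a b + \<phi> a b'" "\<phi> (a + a') b = \<phi> a b + \<phi> a' b" for a a' b b'
    using \<phi> unfolding cu_bimorphism_def by blast+
  show ?thesis unfolding cu_bimorphism_def
  proof (intro conjI allI impI)
    show "mono (\<lambda>a. h (\<phi> (f a) (g b)))" for b
      by (intro monoI gcu_monoD[OF gcu(3)] cu_bimorphism_mono[OF \<phi>] gcu_monoD[OF gcu(1)]) auto
    show "mono (\<lambda>b. h (\<phi> (f a) (g b)))" for a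
      by (intro monoI gcu_monoD[OF gcu(3)] cu_bimorphism_mono[OF \<phi>] gcu_monoD[OF gcu(2)]) auto
    show "h (\<phi> (f a') (g b')) \<lless> h (\<phi> (f a) (g b))" if "a' \<lless> a" "b' \<lless> b" for a' a b' b
      using that by (intro cu_way_below[OF h] cu_bimorphism_way_below[OF \<phi>] cu_way_below[OF f] cu_way_below[OF g])
  qed (simp_all add: gcu[THEN gcu_add] gcu[THEN gcu_zero] zero add sup)
qed


subsection \<open>The endpoint map\<close>

lemma endpoint_class_of: "is_path f \<Longrightarrow> endpoint (class_of f) a = path_sup (\<lambda>l. gcu_apply (f l) a)"
  by (subst endpoint.abs_eq) (auto simp: path_equiv_def path_le_refl)

lemma endpoint_upper: "is_path f \<Longrightarrow> l \<in> IQ \<Longrightarrow> gcu_apply (f l) a \<le> endpoint (class_of f) a"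
  using path_sup_upper[OF IQ_mono_gcu] by (simp add: endpoint_class_of)

lemma endpoint_least:
  "is_path f \<Longrightarrow> (\<And>l. l \<in> IQ \<Longrightarrow> gcu_apply (f l) a \<le> u) \<Longrightarrow> endpoint (class_of f) a \<le> u"
  by (simp add: endpoint_class_of path_sup_least IQ_mono_gcu)

lemma endpoint_mono:
  assumes "x \<le> y" "a \<le> b"
  shows "endpoint x a \<le> endpoint y b"
proof -
  obtain f g where fg: "is_path f" "x = class_of f" "is_path g" "y = class_of g"
    using class_of_cases by metis
  have "endpoint x a \<le> endpoint y a"
    using assms(1) fg by (simp add: le_class_of endpoint_class_of endpoint_le)
  also have "\<dots> \<le> endpoint y b"
    unfolding fg(4)
    by (rule endpoint_least[OF fg(3) order_trans[OF gcu_monoD[OF gcu_apply_gcu assms(2)] endpoint_upper[OF fg(3)]]])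
  finally show ?thesis .
qed

text \<open>The parameters \<open>l * s\<close> of the cut path stay below \<open>s\<close>. Thus
  whenever \<open>x' \<lless> x\<close>, a single generalized morphism \<open>f s\<close> separates
  the endpoints of \<open>x'\<close> and \<open>x\<close>.\<close>

lemma endpoint_shrink_le:
  assumes "is_path f" "s \<in> IQ"
  shows "endpoint (class_of (shrink f s)) a \<le> gcu_apply (f s) a"
proof (rule endpoint_least[OF path_cut[OF assms]])
  fix l assume "l \<in> IQ"
  hence "shrink f s l \<prec> f s" unfolding shrink_def using IQ_mult pathD[OF assms(1)] assms(2) by blast
  thus "gcu_apply (shrink f s l) a \<le> gcu_apply (f s) a" by (rule prec_gcu_le)
qed

text \<open>Two parameters \<open>s < t\<close> fit between the endpoints of \<open>x'\<close> and
  \<open>x\<close>, and \<open>f s \<prec> f t\<close> turns \<open>a' \<lless> a\<close> into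
  \<open>\<lless>\<close> of the values.\<close>

lemma endpoint_way_below:
  assumes "x' \<lless> x" "a' \<lless> a"
  shows "endpoint x' a' \<lless> endpoint x a"
proof -
  obtain f where f: "is_path f" "x = class_of f" using class_of_cases by blast
  obtain s where s: "s \<in> IQ" "x' \<le> class_of (shrink f s)" using way_below_class_of assms(1) f by blast
  obtain t where t: "t \<in> IQ" "s < t" using IQ_above s(1) by blast
  have "endpoint x' a' \<le> endpoint (class_of (shrink f s)) a'" using s(2) by (simp add: endpoint_mono)
  also have "\<dots> \<le> gcu_apply (f s) a'" by (rule endpoint_shrink_le[OF f(1) s(1)])
  also have "\<dots> \<lless> gcu_apply (f t) a"
    using pathD[OF f(1) s(1) t] assms(2) by (simp add: prec_gcu.rep_eq)
  also have "\<dots> \<le> endpoint x a" using endpoint_upper f t by blast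
  finally show ?thesis .
qed

lemma endpoint_sup:
  assumes c: "incseq c" "is_sup (range c) x" and d: "incseq d" "is_sup (range d) a"
  shows "is_sup (range (\<lambda>n. endpoint (c n) (d n))) (endpoint x a)"
proof (rule is_supI)
  show "y \<le> endpoint x a" if "y \<in> range (\<lambda>n. endpoint (c n) (d n))" for y
    using that is_sup_upper[OF c(2)] is_sup_upper[OF d(2)] by (auto intro: endpoint_mono)
  fix u assume u: "\<And>y. y \<in> range (\<lambda>n. endpoint (c n) (d n)) \<Longrightarrow> y \<le> u"
  obtain F h where F: "\<And>n. is_path (F n) \<and> c n = class_of (F n)" "is_path h"
    "\<forall>l\<in>IQ. \<exists>n. \<exists>m\<in>IQ. h l \<prec> F n m" "is_sup (range c) (class_of h)"
    using class_seq_sup[OF c(1)] by blast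
  have x: "x = class_of h" using is_sup_unique c(2) F(4) by blast
  show "endpoint x a \<le> u" unfolding x
  proof (rule endpoint_least[OF F(2)])
    fix l assume "l \<in> IQ"
    then obtain n m where nm: "m \<in> IQ" "h l \<prec> F n m" using F(3) by blast
    show "gcu_apply (h l) a \<le> u"
    \<comment> \<open>\<open>gcu_apply (h l)\<close> preserves the supremum of \<open>d\<close>, so
      it is enough to bound its value at each \<open>d k\<close>. The index \<open>n\<close> from
      \<open>c\<close> and the index \<open>k\<close> from \<open>d\<close> then meet at
      \<open>max n k\<close>.\<close>
    proof (rule is_sup_least[OF gcu_sup[OF gcu_apply_gcu d]], clarify)
      fix k
      have "gcu_apply (h l) (d k) \<le> gcu_apply (F n m) (d k)" by (rule prec_gcu_le[OF nm(2)])
      also have "\<dots> \<le> endpoint (c n) (d k)" using F(1) endpoint_upper nm(1) by metis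
      also have "\<dots> \<le> endpoint (c (max n k)) (d (max n k))"
        using c(1) d(1) by (intro endpoint_mono) (auto intro: monoD)
      also have "\<dots> \<le> u" using u by blast
      finally show "gcu_apply (h l) (d k) \<le> u" .
    qed
  qed
qed

lemma gcu_apply_plus: "gcu_apply (f + g) a = gcu_apply f a + gcu_apply g a"
  by (simp add: plus_gcu.rep_eq)

lemma gcu_apply_Gcu: "generalized_cu_morphism f \<Longrightarrow> gcu_apply (Gcu f) = f"
  by (simp add: Gcu_inverse)

text \<open>This makes \<open>hom_transpose\<close> well defined at Cu-morphisms;
  \<open>eval_map\<close> is the lift of this very map.\<close>

lemma endpoint_bimorphism: "cu_bimorphism (endpoint :: ('a::cu_semigroup, 'b::cu_semigroup) ihom \<Rightarrow> 'a \<Rightarrow> 'b)"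
  unfolding cu_bimorphism_def
proof (intro conjI allI impI)
  fix x y :: "('a, 'b) ihom" and a b
  obtain f g where fg: "is_path f" "x = class_of f" "is_path g" "y = class_of g"
    using class_of_cases by metis
  show "endpoint (x + y) a = endpoint x a + endpoint y a"
    using fg by (simp add: plus_class_of endpoint_class_of path_add gcu_apply_plus path_sup_add IQ_mono_gcu)
  show "endpoint x (a + b) = endpoint x a + endpoint x b"
    using fg by (simp add: endpoint_class_of gcu_add[OF gcu_apply_gcu] path_sup_add IQ_mono_gcu)
  have "endpoint x 0 \<le> 0" unfolding fg(2)
    by (rule endpoint_least[OF fg(1)]) (simp add: gcu_zero[OF gcu_apply_gcu])
  thus "endpoint x 0 = 0" using zero_least order_antisym by blast
  have "endpoint (0 :: ('a, 'b) ihom) a \<le> 0" unfolding zero_path_class.abs_eq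
    by (rule endpoint_least[OF path_zero]) (simp add: zero_gcu.rep_eq)
  thus "endpoint (0 :: ('a, 'b) ihom) a = 0" using zero_least order_antisym by blast
qed (auto intro: monoI endpoint_mono endpoint_way_below endpoint_sup)

text \<open>
  The endpoint map is not injective, but strict inequalities on both sides leave enough room to
  recover the order of the internal hom from the endpoints.
\<close>

lemma le_if_endpoint_le:
  assumes "x' \<lless> x" "y' \<lless> y" "\<And>a. endpoint x a \<le> endpoint y' a"
  shows "x' \<le> y"
proof -
  obtain f g where fg: "is_path f" "x = class_of f" "is_path g" "y = class_of g"
    using class_of_cases by metis
  obtain s t where st: "s \<in> IQ" "x' \<le> class_of (shrink f s)" "t \<in> IQ" "y' \<le> class_of (shrink g t)"
    using way_below_class_of assms fg by metis
  \<comment> \<open>The bound \<open>g t\<close> does not depend on \<open>l\<close>. The strictness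
    is spent between \<open>shrink f s l\<close> and \<open>f s\<close>, so that the endpoints are
    compared at one and the same \<open>a\<close>.\<close>
  have "shrink f s l \<prec> g t" if "l \<in> IQ" for l
    unfolding prec_gcu.rep_eq
  proof (intro allI impI)
    fix a' a :: 'a assume a: "a' \<lless> a"
    have "shrink f s l \<prec> f s" unfolding shrink_def using IQ_mult pathD[OF fg(1)] st(1) that by blast
    hence "gcu_apply (shrink f s l) a' \<lless> gcu_apply (f s) a" using a by (simp add: prec_gcu.rep_eq)
    also have "\<dots> \<le> endpoint x a" using endpoint_upper fg st by blast
    also have "\<dots> \<le> endpoint (class_of (shrink g t)) a" 
      using assms(3) endpoint_mono[OF st(4) order_refl] order_trans by blast
    also have "\<dots> \<le> gcu_apply (g t) a" by (rule endpoint_shrink_le[OF fg(3) st(3)])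
    finally show "gcu_apply (shrink f s l) a' \<lless> gcu_apply (g t) a" .
  qed
  hence "class_of (shrink f s) \<le> y"
    using fg st(1,3) by (auto simp: le_class_of path_cut path_le_def)
  thus ?thesis using st(2) order_trans by blast
qed

text \<open>A Cu-morphism carries the gaps of its domain into the internal hom, where they meet the
  hypotheses of \<open>le_if_endpoint_le\<close>. This yields the uniqueness half of the
  adjunction.\<close>

lemma cu_morphism_le_if_endpoint_le:
  assumes \<alpha>: "cu_morphism \<alpha>" and \<beta>: "cu_morphism \<beta>"
    and le: "\<And>a b. endpoint (\<alpha> a) b \<le> endpoint (\<beta> a) b"
  shows "\<alpha> a \<le> \<beta> a"
proof -
  obtain c where c: "incseq c" "is_sup (range c) a" "\<And>n. c n \<lless> a" using ex_approx_seq[of a] by blast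
  have "\<alpha> (c n) \<le> \<beta> a" for n
  proof -
    \<comment> \<open>The endpoints are compared at \<open>z\<close>, with room on both sides:
      \<open>\<alpha> (c n) \<lless> \<alpha> z\<close> and
      \<open>\<beta> z \<lless> \<beta> a\<close>.\<close>
    obtain z where "c n \<lless> z" "z \<lless> a" using c(3) way_below_interp1 by blast
    thus ?thesis using le_if_endpoint_le cu_way_below \<alpha> \<beta> le by blast
  qed
  thus ?thesis using is_sup_least[OF gcu_sup[OF cu_gcu[OF \<alpha>] c(1,2)]] by blast
qed

lemma cu_morphism_eq_if_endpoint_eq:
  assumes "cu_morphism \<alpha>" "cu_morphism \<beta>" "\<And>a b. endpoint (\<alpha> a) b = endpoint (\<beta> a) b"
  shows "\<alpha> = \<beta>"
  by (rule ext, rule order_antisym; rule cu_morphism_le_if_endpoint_le) (use assms in auto)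


subsection \<open>The adjunction\<close>

text \<open>A constant path at \<open>\<phi> a\<close> would need
  \<open>Gcu (\<phi> a) \<prec> Gcu (\<phi> a)\<close>, which may fail unless \<open>a\<close> is
  compact. An approximating path of \<open>a\<close> supplies the strict increase.\<close>

definition curry_path :: "('a::cu_semigroup \<Rightarrow> 'b::cu_semigroup \<Rightarrow> 'c::cu_semigroup) \<Rightarrow> 'a \<Rightarrow> rat \<Rightarrow> ('b, 'c) gcu"
  where "curry_path \<phi> a l = Gcu (\<phi> (approx a l))"

context
  fixes \<phi> :: "'a::cu_semigroup \<Rightarrow> 'b::cu_semigroup \<Rightarrow> 'c::cu_semigroup"
  assumes \<phi>: "cu_bimorphism \<phi>"
begin

lemma gcu_apply_curry: "gcu_apply (Gcu (\<phi> a)) = \<phi> a"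
  by (rule gcu_apply_Gcu[OF cu_bimorphism_gcu_right[OF \<phi>]])

lemma curry_prec: "a' \<lless> a \<Longrightarrow> Gcu (\<phi> a') \<prec> Gcu (\<phi> a)"
  by (simp add: prec_gcu.rep_eq gcu_apply_curry cu_bimorphism_way_below[OF \<phi>])

lemma is_path_curry: "is_path (curry_path \<phi> a)"
  by (auto simp: is_path_def curry_path_def intro: curry_prec approx_mono)

lemma curry_plus: "Gcu (\<phi> a) + Gcu (\<phi> b) = Gcu (\<phi> (a + b))"
  by (simp add: gcu_apply_inject[symmetric] plus_gcu.rep_eq gcu_apply_curry cu_bimorphism_add_left[OF \<phi>] fun_eq_iff)

lemma endpoint_curry: "endpoint (class_of (curry_path \<phi> a)) b = \<phi> a b"
proof -
  have m: "IQ_mono (\<lambda>l. \<phi> (approx a l) b)"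
    using IQ_mono_gcu[OF is_path_curry[of a], of b] by (simp add: curry_path_def gcu_apply_curry)
  \<comment> \<open>Continuity in the first variable concerns sequences, so it is used along
    \<open>tseq\<close>, which is cofinal in the rational index set.\<close>
  have "is_sup (range (\<lambda>n. \<phi> (approx a (tseq n)) b)) (\<phi> a b)"
    by (rule gcu_sup[OF cu_bimorphism_gcu_left[OF \<phi>] incseq_approx_tseq is_sup_approx_tseq])
  from path_sup_eq[OF iffD1[OF is_sup_tseq_iff[OF m] this]] show ?thesis
    by (simp add: endpoint_class_of is_path_curry curry_path_def gcu_apply_curry)
qed

lemma curry_mono: "a \<le> a' \<Longrightarrow> class_of (curry_path \<phi> a) \<le> class_of (curry_path \<phi> a')"
  unfolding le_class_of[OF is_path_curry is_path_curry] path_le_def curry_path_def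
  using approx_below ex_approx_above way_below_le_trans curry_prec by metis

text \<open>Existence half of the adjunction. Since \<open>curry_prec\<close> turns
  \<open>\<lless>\<close> into \<open>\<prec>\<close>, each clause reduces to comparing
  approximating paths in the domain.\<close>

lemma curry_morphism: "cu_morphism (\<lambda>a. class_of (curry_path \<phi> a))"
  unfolding cu_morphism_def generalized_cu_morphism_def
proof (intro conjI allI impI)
  fix a b
  have "curry_path \<phi> (a + b) \<lesssim> (\<lambda>l. curry_path \<phi> a l + curry_path \<phi> b l)"
    unfolding path_le_def
  proof
    fix l assume l: "l \<in> IQ"
    \<comment> \<open>\<open>ex_approx_add\<close> only yields \<open>\<le>\<close>; the
      interpolated \<open>z\<close> keeps one strict relation in reserve for
      \<open>curry_prec\<close>.\<close>
    obtain z where z: "approx (a + b) l \<lless> z" "z \<lless> a + b" using approx_below[OF l] way_below_interp1 by blast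
    obtain m where m: "m \<in> IQ" "z \<le> approx a m + approx b m" using ex_approx_add z by blast
    hence "approx (a + b) l \<lless> approx a m + approx b m" using z way_below_le_trans by blast
    thus "\<exists>m\<in>IQ. curry_path \<phi> (a + b) l \<prec> curry_path \<phi> a m + curry_path \<phi> b m"
      using m(1) curry_prec by (auto simp: curry_path_def curry_plus)
  qed
  moreover have "(\<lambda>l. curry_path \<phi> a l + curry_path \<phi> b l) \<lesssim> curry_path \<phi> (a + b)"
    unfolding path_le_def
  proof
    fix l assume l: "l \<in> IQ"
    have "approx a l + approx b l \<lless> a + b" using approx_below[OF l] O3 by blast
    then obtain m where "m \<in> IQ" "approx a l + approx b l \<lless> approx (a + b) m" using ex_approx_above by blast
    thus "\<exists>m\<in>IQ. curry_path \<phi> a l + curry_path \<phi> b l \<prec> curry_path \<phi> (a + b) m"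
      using curry_prec by (auto simp: curry_path_def curry_plus)
  qed
  ultimately have "class_of (curry_path \<phi> (a + b)) = class_of (\<lambda>l. curry_path \<phi> a l + curry_path \<phi> b l)"
    by (intro order_antisym) (simp_all only: le_class_of is_path_curry path_add)
  thus "class_of (curry_path \<phi> (a + b)) = class_of (curry_path \<phi> a) + class_of (curry_path \<phi> b)"
    by (simp only: plus_class_of is_path_curry)
next
  have "approx 0 l = (0 :: 'a)" if "l \<in> IQ" for l
    using approx_below[OF that] way_below_imp_le zero_least order_antisym by blast
  moreover have "Gcu (\<phi> 0) = 0"
    by (simp add: gcu_apply_inject[symmetric] zero_gcu.rep_eq gcu_apply_curry cu_bimorphism_zero_left[OF \<phi>] fun_eq_iff)
  ultimately have "curry_path \<phi> 0 \<lesssim> (\<lambda>_. 0)"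
    using zero_prec by (auto simp: path_le_def curry_path_def)
  hence "class_of (curry_path \<phi> 0) \<le> 0"
    unfolding zero_path_class.abs_eq by (simp add: le_class_of is_path_curry path_zero)
  thus "class_of (curry_path \<phi> 0) = 0" using zero_least order_antisym by blast
next
  show "mono (\<lambda>a. class_of (curry_path \<phi> a))" by (intro monoI curry_mono)
next
  fix c :: "nat \<Rightarrow> 'a" and s assume c: "incseq c" "is_sup (range c) s"
  show "is_sup (range (\<lambda>n. class_of (curry_path \<phi> (c n)))) (class_of (curry_path \<phi> s))"
  proof (rule is_sup_class_of[OF is_path_curry is_path_curry])
    show "curry_path \<phi> (c n) \<lesssim> curry_path \<phi> s" for n
      using curry_mono[OF is_sup_upper[OF c(2)], of "c n"] by (simp add: le_class_of is_path_curry)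
    fix l assume l: "l \<in> IQ"
    obtain z where z: "approx s l \<lless> z" "z \<lless> s" using approx_below[OF l] way_below_interp1 by blast
    obtain n where "z \<le> c n" using way_belowD[OF z(2) c order_refl] by blast
    then obtain m where "m \<in> IQ" "approx s l \<lless> approx (c n) m"
      using z(1) way_below_le_trans ex_approx_above by blast
    thus "\<exists>n. \<exists>m\<in>IQ. curry_path \<phi> s l \<prec> curry_path \<phi> (c n) m"
      using curry_prec by (auto simp: curry_path_def)
  qed
next
  fix a' a :: 'a assume "a' \<lless> a"
  then obtain m where m: "m \<in> IQ" "a' \<lless> approx a m" using ex_approx_above by blast
  \<comment> \<open>Cutting at some \<open>s\<close> above \<open>m\<close> keeps
    \<open>approx a m\<close> available, as the cut path reaches it at the parameter
    \<open>m / s\<close>.\<close>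
  obtain s where s: "s \<in> IQ" "m < s" using IQ_above m(1) by blast
  have ms: "m / s \<in> IQ" "m / s * s = m" using m(1) s by (auto simp: IQ_def)
  have "curry_path \<phi> a' \<lesssim> shrink (curry_path \<phi> a) s"
    unfolding path_le_def
  proof
    fix l assume "l \<in> IQ"
    hence "approx a' l \<lless> approx a m" using m(2) approx_below way_below_trans by blast
    thus "\<exists>m\<in>IQ. curry_path \<phi> a' l \<prec> shrink (curry_path \<phi> a) s m"
      using ms curry_prec by (intro bexI[of _ "m / s"]) (simp_all add: shrink_def curry_path_def)
  qed
  hence "class_of (curry_path \<phi> a') \<le> class_of (shrink (curry_path \<phi> a) s)"
    by (simp add: le_class_of is_path_curry path_cut s)
  also have "\<dots> \<lless> class_of (curry_path \<phi> a)" by (rule cut_way_below[OF is_path_curry s(1)])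
  finally show "class_of (curry_path \<phi> a') \<lless> class_of (curry_path \<phi> a)" .
qed

end

text \<open>
  Unlike \<open>tensor_morphism_le_iff\<close>, this does not ask for preservation of the way-below relation, so
  that it applies to \<open>x \<mapsto> h (x \<otimes> c)\<close> for a fixed \<open>c\<close>.
\<close>

lemma gcu_tensor_eq:
  fixes g h :: "('a::cu_semigroup, 'b::cu_semigroup) tensor \<Rightarrow> 'c::cu_semigroup"
  assumes g: "generalized_cu_morphism g" and h: "generalized_cu_morphism h"
    and eq: "\<And>a b. g (a \<otimes> b) = h (a \<otimes> b)"
  shows "g x = h x"
proof -
  obtain f :: "rat \<Rightarrow> ('a, 'b) formal_sum" where f: "is_path f" "x = class_of f" using class_of_cases by blast
  have "g (sum_extension (\<otimes>) M) = h (sum_extension (\<otimes>) M)" for M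
    unfolding gcu_sum_extension[OF g] gcu_sum_extension[OF h] eq ..
  thus ?thesis
    using gcu_sup[OF g incseq_tensor_sums[OF f(1)] is_sup_tensor_sums[OF f(1)]]
      gcu_sup[OF h incseq_tensor_sums[OF f(1)] is_sup_tensor_sums[OF f(1)]] is_sup_unique
    unfolding f(2) by simp
qed

lemma gcu_tensor_left: "cu_morphism h \<Longrightarrow> generalized_cu_morphism (\<lambda>x. h (x \<otimes> c))"
  by (rule cu_bimorphism_gcu_left[OF cu_bimorphism_comp[OF tensor_bimorphism cu_morphism_id cu_morphism_id]])

lemma cu_morphism_tensor_eq:
  assumes "cu_morphism g" "cu_morphism h" "\<And>a b. g (a \<otimes> b) = h (a \<otimes> b)"
  shows "g = h"
  by (rule ext, rule gcu_tensor_eq) (use assms cu_gcu in auto)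

text \<open>Agreement is extended one tensor at a time: first from \<open>a \<otimes> b\<close> to
  every \<open>x\<close> with \<open>c\<close> fixed, where only generalized morphisms are at hand,
  then from \<open>x \<otimes> c\<close> to the whole product.\<close>

lemma cu_morphism_tensor3_eq:
  assumes g: "cu_morphism g" and h: "cu_morphism h"
    and eq: "\<And>a b c. g ((a \<otimes> b) \<otimes> c) = h ((a \<otimes> b) \<otimes> c)"
  shows "g = h"
proof (rule cu_morphism_tensor_eq[OF g h])
  show "g (x \<otimes> c) = h (x \<otimes> c)" for x c
    by (rule gcu_tensor_eq[OF gcu_tensor_left[OF g] gcu_tensor_left[OF h]]) (rule eq)
qed

section \<open>Existence and uniqueness of transposes\<close>

lemma hom_transpose_bimorphism: "cu_morphism \<alpha> \<Longrightarrow> cu_bimorphism (\<lambda>a b. endpoint (\<alpha> a) b)"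
  by (rule cu_bimorphism_comp[OF endpoint_bimorphism _ cu_morphism_id cu_morphism_id])

lemma hom_transpose:
  assumes "cu_morphism \<alpha>"
  shows "cu_morphism (hom_transpose \<alpha>)" "hom_transpose \<alpha> (a \<otimes> b) = endpoint (\<alpha> a) b"
  using tensor_lift[OF hom_transpose_bimorphism[OF assms]] unfolding hom_transpose_def by auto

text \<open>The definite description is resolved by currying \<open>h\<close> for existence and by
  the determination of Cu-morphisms through endpoints for uniqueness.\<close>

lemma hom_adjoint:
  assumes h: "cu_morphism h"
  shows "cu_morphism (hom_adjoint h)" "endpoint (hom_adjoint h a) b = h (a \<otimes> b)"
proof -
  have \<phi>: "cu_bimorphism (\<lambda>a b. h (a \<otimes> b))"
    by (rule cu_bimorphism_comp[OF tensor_bimorphism cu_morphism_id cu_morphism_id h])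
  let ?P = "\<lambda>\<alpha>. cu_morphism \<alpha> \<and> hom_transpose \<alpha> = h"
  have "\<exists>!\<alpha>. ?P \<alpha>"
  proof (rule ex_ex1I)
    let ?\<alpha> = "\<lambda>a. class_of (curry_path (\<lambda>a b. h (a \<otimes> b)) a)"
    have \<alpha>: "cu_morphism ?\<alpha>" by (rule curry_morphism[OF \<phi>])
    have "hom_transpose ?\<alpha> = h"
      by (rule cu_morphism_tensor_eq[OF hom_transpose(1)[OF \<alpha>] h])
        (simp add: hom_transpose(2)[OF \<alpha>] endpoint_curry[OF \<phi>])
    thus "\<exists>\<alpha>. ?P \<alpha>" using \<alpha> by blast
    show "\<alpha> = \<beta>" if "?P \<alpha>" "?P \<beta>" for \<alpha> \<beta>
      using that by (intro cu_morphism_eq_if_endpoint_eq) (auto simp: hom_transpose(2)[symmetric])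
  qed
  from theI'[OF this] have P: "?P (hom_adjoint h)" unfolding hom_adjoint_def .
  thus "cu_morphism (hom_adjoint h)" by blast
  show "endpoint (hom_adjoint h a) b = h (a \<otimes> b)" using hom_transpose(2)[of "hom_adjoint h"] P by simp
qed


subsection \<open>Composition of paths and associativity of the tensor product\<close>

lift_definition gcu_compose ::
  "('b::cu_semigroup, 'c::cu_semigroup) gcu \<Rightarrow> ('a::cu_semigroup, 'b) gcu \<Rightarrow> ('a, 'c) gcu" is "(\<circ>)"
  by (rule gcu_comp)

lemma gcu_compose_prec: "f \<prec> f' \<Longrightarrow> g \<prec> g' \<Longrightarrow> gcu_compose f g \<prec> gcu_compose f' g'"
  by transfer auto

lemma is_path_compose: "is_path f \<Longrightarrow> is_path g \<Longrightarrow> is_path (\<lambda>l. gcu_compose (f l) (g l))"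
  by (auto simp: is_path_def gcu_compose_prec)

text \<open>The factors are dominated at possibly different parameters. Any parameter above both
  serves, since the paths increase.\<close>

lemma prec_compose_above:
  assumes "is_path f" "is_path g" "m \<in> IQ" "n \<in> IQ" "u \<prec> f m" "v \<prec> g n"
  shows "\<exists>t\<in>IQ. gcu_compose u v \<prec> gcu_compose (f t) (g t)"
proof -
  obtain t where t: "t \<in> IQ" "m < t" "n < t" using IQ_above2 assms by blast
  have "u \<prec> f t" "v \<prec> g t"
    using prec_trans[OF assms(5) pathD[OF assms(1,3) t(1,2)]]
      prec_trans[OF assms(6) pathD[OF assms(2,4) t(1,3)]] .
  thus ?thesis using t(1) gcu_compose_prec by blast
qed

lemma path_le_compose:
  "is_path f' \<Longrightarrow> is_path g' \<Longrightarrow> f \<lesssim> f' \<Longrightarrow> g \<lesssim> g' \<Longrightarrow>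
    (\<lambda>l. gcu_compose (f l) (g l)) \<lesssim> (\<lambda>l. gcu_compose (f' l) (g' l))"
  unfolding path_le_def using prec_compose_above by metis

text \<open>Levelwise composition is introduced directly because \<open>comp_map\<close> is defined
  through the associator, whose construction itself needs a composition.\<close>

lift_definition ihom_compose ::
  "('b::cu_semigroup, 'c::cu_semigroup) ihom \<Rightarrow> ('a::cu_semigroup, 'b) ihom \<Rightarrow> ('a, 'c) ihom"
  is "\<lambda>f g l. gcu_compose (f l) (g l)"
  by (simp add: path_equiv_def is_path_compose path_le_compose)

lemma ihom_compose_class_of:
  "is_path f \<Longrightarrow> is_path g \<Longrightarrow>
    ihom_compose (class_of f) (class_of g) = class_of (\<lambda>l. gcu_compose (f l) (g l))"
  by (intro ihom_compose.abs_eq) (auto simp: path_equiv_def path_le_refl)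

lemma ihom_compose_mono:
  assumes "x \<le> x'" "y \<le> y'"
  shows "ihom_compose x y \<le> ihom_compose x' y'"
proof -
  obtain f g f' g' where "is_path f" "x = class_of f" "is_path g" "y = class_of g"
    "is_path f'" "x' = class_of f'" "is_path g'" "y' = class_of g'"
    using class_of_cases by metis
  thus ?thesis using assms by (simp add: ihom_compose_class_of le_class_of is_path_compose path_le_compose)
qed

lemma ihom_compose_way_below:
  assumes "x' \<lless> x" "y' \<lless> y"
  shows "ihom_compose x' y' \<lless> ihom_compose x y"
proof -
  obtain f g where fg: "is_path f" "x = class_of f" "is_path g" "y = class_of g" using class_of_cases by metis
  obtain s t where st: "s \<in> IQ" "x' \<le> class_of (shrink f s)" "t \<in> IQ" "y' \<le> class_of (shrink g t)"
    using way_below_class_of assms fg by metis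
  \<comment> \<open>Both factors are cut at a common \<open>r\<close>, because the composite of the
    two cuts is then the cut of the composite path.\<close>
  obtain r where r: "r \<in> IQ" "s < r" "t < r" using IQ_above2 st by blast
  have "x' \<le> class_of (shrink f r)" "y' \<le> class_of (shrink g r)"
    using st cut_way_below_cut[OF fg(1) st(1) r(1,2)] cut_way_below_cut[OF fg(3) st(3) r(1,3)]
      way_below_imp_le order_trans by blast+
  hence "ihom_compose x' y' \<le> ihom_compose (class_of (shrink f r)) (class_of (shrink g r))"
    by (rule ihom_compose_mono)
  also have "\<dots> = class_of (shrink (\<lambda>l. gcu_compose (f l) (g l)) r)"
    using fg r by (simp add: ihom_compose_class_of path_cut) (simp add: shrink_def[abs_def])
  also have "\<dots> \<lless> ihom_compose x y"
    using fg r by (simp add: ihom_compose_class_of cut_way_below is_path_compose)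
  finally show ?thesis .
qed

lemma ihom_compose_sup:
  assumes cd: "incseq c" "incseq d" "is_sup (range c) s" "is_sup (range d) t"
  shows "is_sup (range (\<lambda>n. ihom_compose (c n) (d n))) (ihom_compose s t)"
proof -
  obtain F h where F: "\<And>n. is_path (F n) \<and> c n = class_of (F n)" "is_path h" "\<And>n. F n \<lesssim> F (Suc n)"
    "\<forall>l\<in>IQ. \<exists>n. \<exists>m\<in>IQ. h l \<prec> F n m" "is_sup (range c) (class_of h)"
    using class_seq_sup[OF cd(1)] by blast
  obtain G k where G: "\<And>n. is_path (G n) \<and> d n = class_of (G n)" "is_path k" "\<And>n. G n \<lesssim> G (Suc n)"
    "\<forall>l\<in>IQ. \<exists>n. \<exists>m\<in>IQ. k l \<prec> G n m" "is_sup (range d) (class_of k)"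
    using class_seq_sup[OF cd(2)] by blast
  have s: "s = class_of h" and t: "t = class_of k" using is_sup_unique cd F(5) G(5) by blast+
  have Fh: "F n \<lesssim> h" for n using is_sup_upper[OF F(5), of "c n"] F(1,2) by (simp add: le_class_of)
  have Gk: "G n \<lesssim> k" for n using is_sup_upper[OF G(5), of "d n"] G(1,2) by (simp add: le_class_of)
  have "is_sup (range (\<lambda>n. class_of (\<lambda>l. gcu_compose (F n l) (G n l)))) (class_of (\<lambda>l. gcu_compose (h l) (k l)))"
  proof (rule is_sup_class_of)
    fix l assume l: "l \<in> IQ"
    obtain n m where m: "m \<in> IQ" "h l \<prec> F n m" using F(4) l by blast
    obtain n' m' where m': "m' \<in> IQ" "k l \<prec> G n' m'" using G(4) l by blast
    \<comment> \<open>Both values are moved to one index \<open>N\<close>; their parameters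
      \<open>p\<close> and \<open>q\<close> are then merged by
      \<open>prec_compose_above\<close>.\<close>
    define N where "N = max n n'"
    have "F n \<lesssim> F N" by (rule path_le_chain[of F]) (use F in \<open>auto simp: N_def\<close>)
    then obtain p where p: "p \<in> IQ" "h l \<prec> F N p" using m prec_trans unfolding path_le_def by blast
    have "G n' \<lesssim> G N" by (rule path_le_chain[of G]) (use G in \<open>auto simp: N_def\<close>)
    then obtain q where q: "q \<in> IQ" "k l \<prec> G N q" using m' prec_trans unfolding path_le_def by blast
    show "\<exists>n. \<exists>m\<in>IQ. gcu_compose (h l) (k l) \<prec> gcu_compose (F n m) (G n m)"
      using prec_compose_above[of "F N" "G N", OF _ _ p(1) q(1) p(2) q(2)] F(1) G(1) by blast
  qed (use F G Fh Gk is_path_compose path_le_compose in blast)+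
  thus ?thesis using F G s t by (simp add: ihom_compose_class_of)
qed

lemma ihom_compose_bimorphism:
  "cu_bimorphism (ihom_compose :: ('b::cu_semigroup, 'c::cu_semigroup) ihom \<Rightarrow> ('a::cu_semigroup, 'b) ihom \<Rightarrow> _)"
  unfolding cu_bimorphism_def
proof (intro conjI allI impI)
  fix x x' :: "('b, 'c) ihom" and y y' :: "('a, 'b) ihom"
  obtain f f' g g' where fg: "is_path f" "x = class_of f" "is_path f'" "x' = class_of f'"
    "is_path g" "y = class_of g" "is_path g'" "y' = class_of g'"
    using class_of_cases by metis
  have "gcu_compose (u + u') v = gcu_compose u v + gcu_compose u' v"
    for u u' :: "('b, 'c) gcu" and v :: "('a, 'b) gcu"
    by transfer auto
  thus "ihom_compose (x + x') y = ihom_compose x y + ihom_compose x' y"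
    using fg by (simp add: plus_class_of ihom_compose_class_of path_add is_path_compose)
  have "gcu_compose u (v + v') = gcu_compose u v + gcu_compose u v'"
    for u :: "('b, 'c) gcu" and v v' :: "('a, 'b) gcu"
    by transfer (auto simp: gcu_add)
  thus "ihom_compose x (y + y') = ihom_compose x y + ihom_compose x y'"
    using fg by (simp add: plus_class_of ihom_compose_class_of path_add is_path_compose)
  have "gcu_compose (0 :: ('b, 'c) gcu) v = 0" for v :: "('a, 'b) gcu"
    by (simp add: gcu_apply_inject[symmetric] gcu_compose.rep_eq zero_gcu.rep_eq fun_eq_iff)
  thus "ihom_compose (0 :: ('b, 'c) ihom) y = 0"
    using fg unfolding zero_path_class.abs_eq by (simp add: ihom_compose_class_of path_zero)
  have "gcu_compose u (0 :: ('a, 'b) gcu) = 0" for u :: "('b, 'c) gcu"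
    by (simp add: gcu_apply_inject[symmetric] gcu_compose.rep_eq zero_gcu.rep_eq fun_eq_iff gcu_zero[OF gcu_apply_gcu])
  thus "ihom_compose x (0 :: ('a, 'b) ihom) = 0"
    using fg unfolding zero_path_class.abs_eq by (simp add: ihom_compose_class_of path_zero)
qed (auto intro: monoI ihom_compose_mono ihom_compose_way_below ihom_compose_sup)

text \<open>The right side is an iterated supremum of the values of \<open>f l\<close> at those of
  \<open>g m\<close>, the left side the supremum over the diagonal \<open>l = m\<close>. The
  diagonal is cofinal since both paths increase.\<close>

lemma endpoint_ihom_compose: "endpoint (ihom_compose x y) a = endpoint x (endpoint y a)"
proof -
  obtain f g where fg: "is_path f" "x = class_of f" "is_path g" "y = class_of g" using class_of_cases by metis
  let ?gs = "\<lambda>n. gcu_apply (g (tseq n)) a"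
  note path = is_path_compose[OF fg(1,3)]
  have eq: "ihom_compose x y = class_of (\<lambda>l. gcu_compose (f l) (g l))"
    using fg by (simp add: ihom_compose_class_of)
  show ?thesis
  proof (rule order_antisym)
    show "endpoint (ihom_compose x y) a \<le> endpoint x (endpoint y a)"
      unfolding eq
    proof (rule endpoint_least[OF path])
      fix l assume l: "l \<in> IQ"
      have "gcu_apply (gcu_compose (f l) (g l)) a \<le> gcu_apply (f l) (endpoint y a)"
        using endpoint_upper[OF fg(3) l] fg(4) by (simp add: gcu_compose.rep_eq gcu_monoD[OF gcu_apply_gcu])
      also have "\<dots> \<le> endpoint x (endpoint y a)" using endpoint_upper fg(1,2) l by blast
      finally show "gcu_apply (gcu_compose (f l) (g l)) a \<le> endpoint x (endpoint y a)" .
    qed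
    have m: "IQ_mono (\<lambda>l. gcu_apply (g l) a)" by (rule IQ_mono_gcu[OF fg(3)])
    have sup: "is_sup (range ?gs) (endpoint y a)"
      using is_sup_path_sup[OF m] fg(3,4) by (simp add: is_sup_tseq_iff[OF m] endpoint_class_of)
    show "endpoint x (endpoint y a) \<le> endpoint (ihom_compose x y) a"
      unfolding fg(2)
    proof (rule endpoint_least[OF fg(1)])
      fix l assume l: "l \<in> IQ"
      show "gcu_apply (f l) (endpoint y a) \<le> endpoint (ihom_compose (class_of f) y) a"
      proof (rule is_sup_least[OF gcu_sup[OF gcu_apply_gcu IQ_mono_tseq[OF m] sup]], clarify)
        fix n
        \<comment> \<open>After \<open>f l\<close> has been pulled through the supremum over
          \<open>n\<close>, the off-diagonal term at \<open>l\<close> and \<open>tseq n\<close> lies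
          below the diagonal term at \<open>t\<close>.\<close>
        obtain t where t: "t \<in> IQ" "l < t" "tseq n < t" using IQ_above2 l tseq_IQ by blast
        have "gcu_apply (f l) (?gs n) \<le> gcu_apply (f t) (?gs n)"
          by (rule prec_gcu_le[OF pathD[OF fg(1) l t(1,2)]])
        also have "\<dots> \<le> gcu_apply (f t) (gcu_apply (g t) a)"
          by (rule gcu_monoD[OF gcu_apply_gcu prec_gcu_le[OF pathD[OF fg(3) tseq_IQ t(1,3)]]])
        also have "\<dots> \<le> endpoint (ihom_compose x y) a"
          using endpoint_upper[OF path t(1), of a] unfolding eq by (simp add: gcu_compose.rep_eq)
        finally show "gcu_apply (f l) (?gs n) \<le> endpoint (ihom_compose (class_of f) y) a"
          unfolding fg(2) .
      qed
    qed
  qed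
qed

text \<open>
  The associator is transposed from \<open>a \<otimes> b \<mapsto> (a \<otimes> -) \<circ> (b \<otimes> -)\<close>, where \<open>a \<otimes> -\<close> and \<open>b \<otimes> -\<close> are
  the values of units of the adjunction.
\<close>

lemma tensor_assoc:
  "cu_morphism (tensor_assoc ::
     (('a::cu_semigroup, 'b::cu_semigroup) tensor, 'c::cu_semigroup) tensor \<Rightarrow> ('a, ('b, 'c) tensor) tensor)"
  "(tensor_assoc ::
     (('a, 'b) tensor, 'c) tensor \<Rightarrow> ('a, ('b, 'c) tensor) tensor) ((a \<otimes> b) \<otimes> c) = a \<otimes> (b \<otimes> c)"
proof -
  let ?P = "\<lambda>h :: (('a, 'b) tensor, 'c) tensor \<Rightarrow> ('a, ('b, 'c) tensor) tensor.
    cu_morphism h \<and> (\<forall>a b c. h ((a \<otimes> b) \<otimes> c) = a \<otimes> (b \<otimes> c))"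
  \<comment> \<open>The two identities have different types: the right one is on
    \<open>('b, 'c) tensor\<close>, the left one on
    \<open>('a, ('b, 'c) tensor) tensor\<close>.\<close>
  define \<kappa> :: "'a \<Rightarrow> 'b \<Rightarrow> ('c, ('a, ('b, 'c) tensor) tensor) ihom" where
    "\<kappa> a b = ihom_compose (hom_adjoint (\<lambda>x. x) a) (hom_adjoint (\<lambda>x. x) b)" for a b
  have \<kappa>: "cu_bimorphism \<kappa>"
    unfolding \<kappa>_def[abs_def]
    by (rule cu_bimorphism_comp[OF ihom_compose_bimorphism _ _ cu_morphism_id])
      (rule hom_adjoint(1)[OF cu_morphism_id])+
  have \<kappa>_eq: "endpoint (\<kappa> a b) c = a \<otimes> (b \<otimes> c)" for a b c
    by (simp add: \<kappa>_def endpoint_ihom_compose hom_adjoint(2)[OF cu_morphism_id])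
  have "\<exists>!h. ?P h"
  proof (rule ex_ex1I)
    \<comment> \<open>Lifting \<open>\<kappa>\<close> joins the first two variables, and transposing
      then brings in the third.\<close>
    have "?P (hom_transpose (tensor_lift \<kappa>))"
      by (simp add: hom_transpose[OF tensor_lift(1)[OF \<kappa>]] tensor_lift(2)[OF \<kappa>] \<kappa>_eq)
    thus "\<exists>h. ?P h" by blast
    show "g = h" if "?P g" "?P h" for g h
      using that by (intro cu_morphism_tensor3_eq) auto
  qed
  from theI'[OF this] have "?P tensor_assoc" unfolding tensor_assoc_def .
  thus "cu_morphism (tensor_assoc :: (('a, 'b) tensor, 'c) tensor \<Rightarrow> ('a, ('b, 'c) tensor) tensor)"
    "(tensor_assoc :: (('a, 'b) tensor, 'c) tensor \<Rightarrow> ('a, ('b, 'c) tensor) tensor) ((a \<otimes> b) \<otimes> c) =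
      a \<otimes> (b \<otimes> c)" by blast+
qed


subsection \<open>The composition product and the left regular map\<close>

lemma tensor_map:
  assumes "cu_morphism f" "cu_morphism g"
  shows "cu_morphism (tensor_map f g)" "tensor_map f g (a \<otimes> b) = f a \<otimes> g b"
  using tensor_lift[OF cu_bimorphism_comp[OF tensor_bimorphism assms cu_morphism_id]]
  unfolding tensor_map_def by auto

lemma eval_map: "cu_morphism eval_map" "eval_map (x \<otimes> a) = endpoint x a"
  unfolding eval_map_def using hom_transpose[of id] cu_morphism_id by (auto simp: id_def)

text \<open>The associator rebrackets \<open>(y \<otimes> x) \<otimes> a\<close> to
  \<open>y \<otimes> (x \<otimes> a)\<close>, where the two evaluations apply in turn.\<close>

lemma comp_map:
  fixes y :: "('b::cu_semigroup, 'c::cu_semigroup) ihom" and x :: "('a::cu_semigroup, 'b) ihom"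
  shows "cu_morphism (comp_map :: (('b, 'c) ihom, ('a, 'b) ihom) tensor \<Rightarrow> ('a, 'c) ihom)"
    and "endpoint (comp_map (y \<otimes> x)) a = endpoint y (endpoint x a)"
proof -
  have id: "cu_morphism id" using cu_morphism_id by (simp add: id_def)
  note tm = tensor_map[OF id eval_map(1)]
  have h: "cu_morphism (eval_map \<circ> tensor_map id eval_map \<circ> tensor_assoc ::
    ((('b, 'c) ihom, ('a, 'b) ihom) tensor, 'a) tensor \<Rightarrow> 'c)"
    unfolding comp_def
    by (rule cu_morphism_comp[OF cu_morphism_comp[OF eval_map(1) tm(1)] tensor_assoc(1)])
  show "cu_morphism (comp_map :: (('b, 'c) ihom, ('a, 'b) ihom) tensor \<Rightarrow> ('a, 'c) ihom)"
    unfolding comp_map_def by (rule hom_adjoint(1)[OF h])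
  show "endpoint (comp_map (y \<otimes> x)) a = endpoint y (endpoint x a)"
    unfolding comp_map_def hom_adjoint(2)[OF h] by (simp add: tensor_assoc tm eval_map)
qed

lemma mult_map: "cu_morphism mult_map" "mult_map (r \<otimes> s) = r * s"
  unfolding mult_map_def by (rule tensor_lift[OF mult_bimorphism])+

lemma pi_map: "cu_morphism pi_map" "endpoint (pi_map r) s = r * s"
  unfolding pi_map_def using hom_adjoint[OF mult_map(1)] by (auto simp: mult_map)

lemma pi_map_mult: "pi_map (r * s) = pi_map r \<odot> pi_map s"
proof -
  \<comment> \<open>Equal endpoints for a single pair \<open>r\<close>, \<open>s\<close> would not
    give equality in the internal hom. As functions of \<open>z\<close> on the tensor product both
    sides are Cu-morphisms, and for these endpoints suffice.\<close>
  let ?\<alpha> = "\<lambda>z. pi_map (mult_map z)" and ?\<beta> = "\<lambda>z. comp_map (tensor_map pi_map pi_map z)"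
  note tm = tensor_map[OF pi_map(1) pi_map(1)]
  have \<alpha>: "cu_morphism ?\<alpha>" by (rule cu_morphism_comp[OF pi_map(1) mult_map(1)])
  have \<beta>: "cu_morphism ?\<beta>" by (rule cu_morphism_comp[OF comp_map(1) tm(1)])
  \<comment> \<open>On \<open>(r \<otimes> s) \<otimes> t\<close> this is associativity of the
    multiplication.\<close>
  have eq: "hom_transpose ?\<alpha> = hom_transpose ?\<beta>"
    by (rule cu_morphism_tensor3_eq[OF hom_transpose(1)[OF \<alpha>] hom_transpose(1)[OF \<beta>]])
      (simp add: hom_transpose(2)[OF \<alpha>] hom_transpose(2)[OF \<beta>] mult_map tm comp_map pi_map mult.assoc)
  have "?\<alpha> = ?\<beta>"
    by (rule cu_morphism_eq_if_endpoint_eq[OF \<alpha> \<beta>])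
      (simp only: hom_transpose(2)[OF \<alpha>, symmetric] hom_transpose(2)[OF \<beta>, symmetric] eq)
  from fun_cong[OF this, of "r \<otimes> s"] show ?thesis by (simp add: mult_map tm comp_product_def)
qed

section \<open>Constant paths and the unit\<close>

lemma is_path_ihom_of: "cu_morphism \<phi> \<Longrightarrow> is_path (\<lambda>_. Gcu \<phi>)"
  by (simp add: is_path_def prec_gcu.rep_eq gcu_apply_Gcu[OF cu_gcu] cu_way_below)

text \<open>Cutting a constant path changes nothing, while a cut is way below the original
  class.\<close>

lemma compact_ihom_of:
  assumes "cu_morphism \<phi>"
  shows "ihom_of \<phi> \<lless> ihom_of \<phi>"
  using cut_way_below[OF is_path_ihom_of[OF assms] IQ_nonempty] by (simp add: shrink_def[abs_def] ihom_of_def)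

lemma endpoint_ihom_of:
  assumes "cu_morphism \<phi>"
  shows "endpoint (ihom_of \<phi>) a = \<phi> a"
proof -
  have "is_sup ((\<lambda>_. \<phi> a) ` IQ) (\<phi> a)" using IQ_nonempty by (auto intro!: is_supI)
  thus ?thesis
    by (simp add: ihom_of_def endpoint_class_of is_path_ihom_of assms gcu_apply_Gcu[OF cu_gcu] path_sup_eq)
qed

lemma pi_map_one:
  assumes "compact_elem (1 :: 'r::cu_semiring)"
  shows "pi_map (1 :: 'r) = ihom_of id"
proof -
  have id: "cu_morphism (id :: 'r \<Rightarrow> 'r)" using cu_morphism_id by (simp add: id_def)
  have one: "pi_map (1 :: 'r) \<lless> pi_map 1"
    using cu_way_below[OF pi_map(1)] assms by (simp add: compact_elem_def)
  have "endpoint (pi_map (1 :: 'r)) a = endpoint (ihom_of id) a" for a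
    by (simp add: pi_map endpoint_ihom_of id)
  \<comment> \<open>By compactness \<open>le_if_endpoint_le\<close> applies in both directions with
    \<open>x' = x\<close> and \<open>y' = y\<close>, so that no room is lost.\<close>
  thus ?thesis
    using le_if_endpoint_le[OF one compact_ihom_of[OF id]] le_if_endpoint_le[OF compact_ihom_of[OF id] one]
    by (intro order_antisym) auto
qed

theorem theorem5p11:
  shows "(\<forall>r s :: 'r::cu_semiring. pi_map (r * s) = pi_map r \<odot> pi_map s) \<and>
    (compact_elem (1 :: 'r) \<longrightarrow> pi_map (1 :: 'r) = ihom_of id)"
  using pi_map_mult pi_map_one by blast

end
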